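(* Let $\Bbbk$ be an infinite field, $\mathcal{P}=\Bbbk[x_1,\dots,x_n]$, and let $\mathcal{I}\subset\mathcal{P}$ be a nonzero proper homogeneous ideal of dimension $D=\dim(\mathcal{P}/\mathcal{I})$ possessing a (finite) Pommaret basis $\mathcal{H}$ with respect to the degree reverse lexicographic order with $x_n\prec\cdots\prec x_1$. Then $$\deg(\mathcal{I})=\sum_{\substack{h\in\mathcal{H},\\ D\le |\mathcal{X}_P(h)|\le D+\deg(h)}}(-1)^{|\mathcal{X}_P(h)|-D+1}\binom{\deg(h)}{|\mathcal{X}_P(h)|-D}.$$
   Context: $\mathrm{LT}$ denotes the leading term (without coefficient) with respect to the degree reverse lexicographic order with $x_n\prec\cdots\prec x_1$, and $\mathrm{LT}(\mathcal{I})$ is the leading ideal. For $0\ne f\in\mathcal{P}$ with $\mathrm{LT}(f)=x^\alpha$, $\alpha\neq 0$, the class of $f$ is $\mathrm{cls}(f)=\max\{i\mid \alpha_i\ne 0\}$ and its set of multiplicative variables is $\mathcal{X}_P(f)=\{x_{\mathrm{cls}(f)},\dots,x_n\}$ (so $|\mathcal{X}_P(f)|=n-\mathrm{cls}(f)+1$). The term $x^\beta$ is a Pommaret divisor of $x^\alpha$ if $x^\beta\mid x^\alpha$ and $x^{\alpha-\beta}\in\Bbbk[\mathcal{X}_P(x^\beta)]$. A finite set $\mathcal{H}\subset\mathcal{I}$ of nonzero homogeneous polynomials is a Pommaret basis of $\mathcal{I}$ if no leading term of an element of $\mathcal{H}$ is a Pommaret divisor of the leading term of another element and $\bigoplus_{h\in\mathcal{H}}\Bbbk[\mathcal{X}_P(h)]\cdot\mathrm{LT}(h)=\mathrm{LT}(\mathcal{I})$.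 $D=\dim(\mathcal{I})$ is the Krull dimension of $\mathcal{P}/\mathcal{I}$. The degree $\deg(\mathcal{I})$ is $(D-1)!$ times the leading coefficient of the Hilbert polynomial of $\mathcal{P}/\mathcal{I}$ if $D>0$, and $\dim_{\Bbbk}(\mathcal{P}/\mathcal{I})$ if $D=0$. *)

theory Defs
  imports
    "HOL-Library.Poly_Mapping"
    "HOL-Library.Extended_Nat"
    "HOL-Computational_Algebra.Polynomial"
    "HOL-Algebra.Embedded_Algebras"
    "HOL-Algebra.QuotRing"
begin

section \<open>Polynomial rings as HOL-Algebra structures\<close>

text \<open>A term \<open>x\<^sup>\<alpha>\<close> is encoded by its exponent vector, with the variable \<open>x\<^sub>i\<close> having index \<open>i\<close>.
  Variables are numbered from 1, so index 0 never occurs in \<open>\<k>[x\<^sub>1,\<dots>,x\<^sub>n]\<close>.\<close>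

type_synonym expo = "nat \<Rightarrow>\<^sub>0 nat"

type_synonym 'a mpoly = "expo \<Rightarrow>\<^sub>0 'a"

abbreviation vars :: "expo \<Rightarrow> nat set" where
  "vars \<alpha> \<equiv> Poly_Mapping.keys \<alpha>"

abbreviation supp :: "'a::zero mpoly \<Rightarrow> expo set" where
  "supp f \<equiv> Poly_Mapping.keys f"

abbreviation monomial :: "'a::zero \<Rightarrow> expo \<Rightarrow> 'a mpoly" where
  "monomial c \<alpha> \<equiv> Poly_Mapping.single \<alpha> c"

definition polys_over :: "nat set \<Rightarrow> 'a::comm_ring_1 mpoly set" where
  "polys_over X = {f. \<forall>\<alpha>\<in>supp f. vars \<alpha> \<subseteq> X}"

definition poly_ring :: "nat \<Rightarrow> 'a::comm_ring_1 mpoly ring" where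
  "poly_ring n = \<lparr>carrier = polys_over {1..n}, monoid.mult = (*), one = 1, zero = 0, add = (+)\<rparr>"

lemma cring_poly_ring: "cring (poly_ring n :: 'a::comm_ring_1 mpoly ring)"
proof -
  let ?C = "polys_over {1..n} :: 'a mpoly set"
  have add: "f + g \<in> ?C" if "f \<in> ?C" "g \<in> ?C" for f g
    using that Poly_Mapping.keys_add[of f g] unfolding polys_over_def by blast
  have mult: "f * g \<in> ?C" if f: "f \<in> ?C" and g: "g \<in> ?C" for f g
    unfolding polys_over_def
  proof (intro CollectI ballI)
    fix \<gamma> assume "\<gamma> \<in> supp (f * g)"
    then obtain \<alpha> \<beta> where *: "\<alpha> \<in> supp f" "\<beta> \<in> supp g" "\<gamma> = \<alpha> + \<beta>"
      using keys_mult[of f g] by blast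
    have "vars \<alpha> \<subseteq> {1..n}" "vars \<beta> \<subseteq> {1..n}"
      using f g * unfolding polys_over_def by blast+
    then show "vars \<gamma> \<subseteq> {1..n}"
      using Poly_Mapping.keys_add[of \<alpha> \<beta>] *(3) by blast
  qed
  have minus: "- f \<in> ?C" if "f \<in> ?C" for f
    using that unfolding polys_over_def by (simp add: Poly_Mapping.in_keys_iff)
  have zero: "0 \<in> ?C" and one: "1 \<in> ?C"
    by (simp_all add: polys_over_def)
  show ?thesis
  proof (rule cringI)
    show "abelian_group (poly_ring n :: 'a mpoly ring)"
    proof (rule abelian_groupI)
      show "\<exists>y\<in>carrier (poly_ring n). y \<oplus>\<^bsub>poly_ring n\<^esub> x = \<zero>\<^bsub>poly_ring n\<^esub>"
        if "x \<in> carrier (poly_ring n :: 'a mpoly ring)" for x :: "'a mpoly"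
        by (rule bexI[of _ "- x"]) (use that minus in \<open>simp_all add: poly_ring_def del: One_nat_def\<close>)
    qed (simp_all add: poly_ring_def add zero add.assoc add.commute del: One_nat_def)
    show "comm_monoid (poly_ring n :: 'a mpoly ring)"
      by (rule comm_monoidI)
        (simp_all add: poly_ring_def mult one mult.assoc mult.commute del: One_nat_def)
  qed (simp add: poly_ring_def distrib_right)
qed

section \<open>Gradings\<close>

definition tdeg :: "expo \<Rightarrow> nat" where
  "tdeg \<alpha> = (\<Sum>i\<in>vars \<alpha>. Poly_Mapping.lookup \<alpha> i)"

text \<open>The total degree; the zero polynomial gets degree 0, which is irrelevant below.\<close>

definition poly_deg :: "'a::zero mpoly \<Rightarrow> nat" where
  "poly_deg f = (if f = 0 then 0 else Max (tdeg ` supp f))"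

definition homogeneous_of :: "nat \<Rightarrow> 'a::zero mpoly \<Rightarrow> bool" where
  "homogeneous_of d f \<longleftrightarrow> (\<forall>\<alpha>\<in>supp f. tdeg \<alpha> = d)"

definition homogeneous :: "'a::zero mpoly \<Rightarrow> bool" where
  "homogeneous f \<longleftrightarrow> (\<exists>d. homogeneous_of d f)"

definition homogeneous_ideal :: "nat \<Rightarrow> 'a::comm_ring_1 mpoly set \<Rightarrow> bool" where
  "homogeneous_ideal n I \<longleftrightarrow>
     (\<exists>S \<subseteq> carrier (poly_ring n). (\<forall>f\<in>S. homogeneous f) \<and> I = Idl\<^bsub>poly_ring n\<^esub> S)"

section \<open>Leading terms\<close>

text \<open>Degree reverse lexicographic order with \<open>x\<^sub>n \<prec> \<dots> \<prec> x\<^sub>1\<close>: among terms of equal degree, the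
  smaller one has the larger exponent at the last position where the exponents differ.\<close>

definition drl_less :: "expo \<Rightarrow> expo \<Rightarrow> bool" where
  "drl_less \<alpha> \<beta> \<longleftrightarrow> tdeg \<alpha> < tdeg \<beta> \<or>
     tdeg \<alpha> = tdeg \<beta> \<and>
     (\<exists>i. Poly_Mapping.lookup \<alpha> i > Poly_Mapping.lookup \<beta> i \<and>
          (\<forall>j>i. Poly_Mapping.lookup \<alpha> j = Poly_Mapping.lookup \<beta> j))"

definition lead_expo :: "'a::zero mpoly \<Rightarrow> expo" where
  "lead_expo f = (THE \<alpha>. \<alpha> \<in> supp f \<and> (\<forall>\<beta>\<in>supp f. \<beta> \<noteq> \<alpha> \<longrightarrow> drl_less \<beta> \<alpha>))"

definition LT :: "'a::comm_ring_1 mpoly \<Rightarrow> 'a mpoly" where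
  "LT f = monomial 1 (lead_expo f)"

definition leading_ideal :: "nat \<Rightarrow> 'a::comm_ring_1 mpoly set \<Rightarrow> 'a mpoly set" where
  "leading_ideal n I = Idl\<^bsub>poly_ring n\<^esub> (LT ` (I - {0}))"

section \<open>Pommaret bases\<close>

text \<open>\<open>cls\<close> is meaningful only for terms different from 1.\<close>

definition cls :: "expo \<Rightarrow> nat" where
  "cls \<alpha> = Max (vars \<alpha>)"

definition mult_vars :: "nat \<Rightarrow> expo \<Rightarrow> nat set" where
  "mult_vars n \<alpha> = {cls \<alpha>..n}"

definition XP :: "nat \<Rightarrow> 'a::zero mpoly \<Rightarrow> nat set" where
  "XP n f = mult_vars n (lead_expo f)"

definition pommaret_divides :: "nat \<Rightarrow> expo \<Rightarrow> expo \<Rightarrow> bool" where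
  "pommaret_divides n \<beta> \<alpha> \<longleftrightarrow> (\<exists>\<gamma>. \<alpha> = \<beta> + \<gamma> \<and> vars \<gamma> \<subseteq> mult_vars n \<beta>)"

definition pommaret_cone :: "nat \<Rightarrow> 'a::comm_ring_1 mpoly \<Rightarrow> 'a mpoly set" where
  "pommaret_cone n h = {p * LT h |p. p \<in> polys_over (XP n h)}"

text \<open>\<open>V\<close> is the internal direct sum of the family of additive subgroups \<open>C h\<close>, \<open>h \<in> H\<close>.\<close>

definition is_direct_sum :: "'i set \<Rightarrow> ('i \<Rightarrow> 'b::comm_monoid_add set) \<Rightarrow> 'b set \<Rightarrow> bool" where
  "is_direct_sum H C V \<longleftrightarrow>
     V = {\<Sum>h\<in>H. g h |g. \<forall>h\<in>H. g h \<in> C h} \<and>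
     (\<forall>g. (\<forall>h\<in>H. g h \<in> C h) \<and> (\<Sum>h\<in>H. g h) = 0 \<longrightarrow> (\<forall>h\<in>H. g h = 0))"

definition pommaret_basis ::
  "nat \<Rightarrow> 'a::comm_ring_1 mpoly set \<Rightarrow> 'a mpoly set \<Rightarrow> bool" where
  "pommaret_basis n I H \<longleftrightarrow>
     finite H \<and> H \<subseteq> I \<and> (\<forall>h\<in>H. h \<noteq> 0 \<and> homogeneous h) \<and>
     (\<forall>g\<in>H. \<forall>h\<in>H. g \<noteq> h \<longrightarrow> \<not> pommaret_divides n (lead_expo g) (lead_expo h)) \<and>
     is_direct_sum H (pommaret_cone n) (leading_ideal n I)"

section \<open>Krull dimension\<close>

definition krull_dim :: "('a, 'b) ring_scheme \<Rightarrow> enat" where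
  "krull_dim R = Sup {enat m |m. \<exists>\<pp> :: nat \<Rightarrow> 'a set.
     (\<forall>i\<le>m. primeideal (\<pp> i) R) \<and> (\<forall>i<m. \<pp> i \<subset> \<pp> (Suc i))}"

definition ideal_dim :: "nat \<Rightarrow> 'a::comm_ring_1 mpoly set \<Rightarrow> enat" where
  "ideal_dim n I = krull_dim (poly_ring n Quot I)"

section \<open>Hilbert polynomial and degree\<close>

definition residue :: "nat \<Rightarrow> 'a::comm_ring_1 mpoly set \<Rightarrow> 'a mpoly \<Rightarrow> 'a mpoly set" where
  "residue n I f = I +>\<^bsub>poly_ring n\<^esub> f"

text \<open>The \<open>\<k>\<close>-dimension of the image in \<open>\<P>/\<I>\<close> of a subspace \<open>V\<close> of \<open>\<P>\<close>. For proper \<open>\<I>\<close> the field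
  \<open>\<k>\<close> is identified with its isomorphic image in \<open>\<P>/\<I>\<close>.\<close>

definition quot_dim :: "nat \<Rightarrow> 'a::field mpoly set \<Rightarrow> 'a mpoly set \<Rightarrow> nat" where
  "quot_dim n I V =
     ring.dim (poly_ring n Quot I) (range (\<lambda>c. residue n I (monomial c 0))) (residue n I ` V)"

definition hilbert_function :: "nat \<Rightarrow> 'a::field mpoly set \<Rightarrow> nat \<Rightarrow> nat" where
  "hilbert_function n I d = quot_dim n I {f \<in> carrier (poly_ring n). homogeneous_of d f}"

definition hilbert_polynomial :: "nat \<Rightarrow> 'a::field mpoly set \<Rightarrow> rat poly" where
  "hilbert_polynomial n I =
     (THE p. \<forall>\<^sub>F d in sequentially. poly p (of_nat d) = of_nat (hilbert_function n I d))"

definition ideal_degree :: "nat \<Rightarrow> 'a::field mpoly set \<Rightarrow> rat" where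
  "ideal_degree n I =
     (let D = the_enat (ideal_dim n I) in
      if D > 0 then fact (D - 1) * lead_coeff (hilbert_polynomial n I)
      else of_nat (quot_dim n I (carrier (poly_ring n))))"

end

theory Submission
  imports Defs
begin

text \<open>
  Since the order is degree compatible, the Hilbert function of \<open>\<P>/\<I>\<close> counts standard terms, those
  outside \<open>LT(\<I>)\<close>, and a Pommaret basis partitions \<open>LT(\<I>)\<close> into cones. Expanding the sizes of the
  cones, the number of standard terms of degree at most \<open>d\<close> becomes \<open>\<Sum>\<^sub>i a\<^sub>i binom(d + i, i)\<close> for large
  \<open>d\<close>, with the claimed right-hand side as \<open>a\<^sub>D\<close> (because \<open>D < n\<close>). It remains to see that this number
  grows exactly like \<open>d\<^sup>D\<close>, so that \<open>a\<^sub>D\<close> is the top coefficient.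

  Growth of order at least \<open>D\<close>: for primes \<open>p \<subset> q\<close> and \<open>f \<in> q - p\<close> of degree \<open>e\<close>, multiplication by
  \<open>f\<close> is injective modulo \<open>p\<close>, so \<open>F\<^sub>q(d) + F\<^sub>p(d - e) \<le> F\<^sub>p(d)\<close>; each step of a chain of primes
  raises the order of growth by one.

  Growth of order at most \<open>D\<close>: otherwise some \<open>D + 1\<close> variables \<open>Y\<close> satisfy \<open>\<I> \<inter> k[Y] = 0\<close>. For a
  graded ideal \<open>J\<close> with \<open>J \<inter> k[Y] = 0\<close>, a graded ideal containing \<open>J\<close> and maximal with this property
  is a prime \<open>p\<close>. Adding a variable from \<open>Y\<close> to \<open>p\<close> lowers the order of growth by at most one, so
  again \<open>|Y| - 1\<close> variables are free modulo the larger ideal. Iterating yields a chain of primes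
  of length \<open>D + 1\<close>.
\<close>

abbreviation lookup :: "('a \<Rightarrow>\<^sub>0 'b::zero) \<Rightarrow> 'a \<Rightarrow> 'b" where
  "lookup \<equiv> Poly_Mapping.lookup"

section \<open>Terms and the degree reverse lexicographic order\<close>

lemma tdeg_eq_sum:
  assumes "finite A" "vars \<alpha> \<subseteq> A"
  shows "tdeg \<alpha> = (\<Sum>i\<in>A. lookup \<alpha> i)"
  unfolding tdeg_def by (rule sum.mono_neutral_left) (use assms in \<open>auto simp: in_keys_iff\<close>)

lemma vars_add: "vars (\<alpha> + \<beta> :: expo) = vars \<alpha> \<union> vars \<beta>"
  by (auto simp: in_keys_iff lookup_add)

lemma tdeg_add: "tdeg (\<alpha> + \<beta>) = tdeg \<alpha> + tdeg \<beta>"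
  using tdeg_eq_sum[of "vars \<alpha> \<union> vars \<beta>"] by (simp add: vars_add lookup_add sum.distrib)

lemma tdeg_zero [simp]: "tdeg 0 = 0"
  by (simp add: tdeg_def)

lemma tdeg_single [simp]: "tdeg (Poly_Mapping.single i k) = k"
  by (simp add: tdeg_def)

lemma lookup_le_tdeg: "lookup \<alpha> i \<le> tdeg \<alpha>"
proof (cases "i \<in> vars \<alpha>")
  case True
  then show ?thesis unfolding tdeg_def by (intro member_le_sum) auto
qed (simp add: in_keys_iff)

lemma tdeg_eq_0_iff [simp]: "tdeg \<alpha> = 0 \<longleftrightarrow> \<alpha> = 0"
proof
  assume "tdeg \<alpha> = 0"
  then have "lookup \<alpha> i = 0" for i using lookup_le_tdeg[of \<alpha> i] by simp
  then show "\<alpha> = 0" by (intro poly_mapping_eqI) simp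
qed simp

lemma drl_less_irrefl [simp]: "\<not> drl_less \<alpha> \<alpha>"
  by (auto simp: drl_less_def)

lemma drl_less_trans:
  assumes "drl_less \<alpha> \<beta>" "drl_less \<beta> \<gamma>"
  shows "drl_less \<alpha> \<gamma>"
proof (cases "tdeg \<alpha> = tdeg \<beta> \<and> tdeg \<beta> = tdeg \<gamma>")
  case True
  then obtain i j where i: "lookup \<alpha> i > lookup \<beta> i" "\<forall>k>i. lookup \<alpha> k = lookup \<beta> k"
    and j: "lookup \<beta> j > lookup \<gamma> j" "\<forall>k>j. lookup \<beta> k = lookup \<gamma> k"
    using assms by (auto simp: drl_less_def)
  \<comment> \<open>The larger of the two witnesses is the last position where \<alpha> and \<gamma>
    differ.\<close>
  have "lookup \<alpha> (max i j) > lookup \<gamma> (max i j)"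
  proof (cases i j rule: linorder_cases)
    case less
    then show ?thesis using i j by (simp add: max_def)
  next
    case equal
    then show ?thesis using i j by simp
  next
    case greater
    then show ?thesis using i j by (simp add: max_def)
  qed
  moreover have "\<forall>k>max i j. lookup \<alpha> k = lookup \<gamma> k" using i j by simp
  ultimately show ?thesis using True unfolding drl_less_def by auto
next
  case False
  then have "tdeg \<alpha> < tdeg \<gamma>" using assms unfolding drl_less_def by linarith
  then show ?thesis by (simp add: drl_less_def)
qed

text \<open>Supports are finite, so distinct exponent vectors have a last position of difference; it
  decides unless the degrees already do.\<close>

lemma drl_less_total:
  assumes "\<alpha> \<noteq> \<beta>"
  shows "drl_less \<alpha> \<beta> \<or> drl_less \<beta> \<alpha>"
proof -
  define A where "A = {i. lookup \<alpha> i \<noteq> lookup \<beta> i}"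
  have "A \<subseteq> vars \<alpha> \<union> vars \<beta>" by (auto simp: A_def in_keys_iff)
  then have fin: "finite A" by (rule finite_subset) simp
  have ne: "A \<noteq> {}" using assms by (auto simp: A_def intro: poly_mapping_eqI)
  have "\<forall>j>Max A. lookup \<alpha> j = lookup \<beta> j"
  proof (intro allI impI, rule ccontr)
    fix j assume "Max A < j" "lookup \<alpha> j \<noteq> lookup \<beta> j"
    then show False using Max_ge[OF fin, of j] by (simp add: A_def)
  qed
  moreover have "lookup \<alpha> (Max A) \<noteq> lookup \<beta> (Max A)" using Max_in[OF fin ne] by (simp add: A_def)
  ultimately show ?thesis unfolding drl_less_def by (metis linorder_less_linear)
qed

lemma drl_less_add_left: "drl_less \<alpha> \<beta> \<Longrightarrow> drl_less (\<gamma> + \<alpha>) (\<gamma> + \<beta>)"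
  by (auto simp: drl_less_def tdeg_add lookup_add)

text \<open>Applied to supports, this makes the definite description in \<open>lead_expo\<close>
  meaningful for nonzero polynomials.\<close>

lemma ex_drl_max:
  assumes "finite A" "A \<noteq> {}"
  shows "\<exists>\<alpha>\<in>A. \<forall>\<beta>\<in>A. \<beta> \<noteq> \<alpha> \<longrightarrow> drl_less \<beta> \<alpha>"
  using assms
proof (induction rule: finite_ne_induct)
  case (insert x F)
  then obtain \<alpha> where \<alpha>: "\<alpha> \<in> F" "\<forall>\<beta>\<in>F. \<beta> \<noteq> \<alpha> \<longrightarrow> drl_less \<beta> \<alpha>" by blast
  show ?case
  proof (cases "drl_less x \<alpha>")
    case True
    then show ?thesis using \<alpha> by auto
  next
    case False
    then have "drl_less \<alpha> x" using drl_less_total[of \<alpha> x] insert \<alpha> by auto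
    then show ?thesis using \<alpha> drl_less_trans by (intro bexI[of _ x]) auto
  qed
qed auto

section \<open>Leading exponents\<close>

lemma lead_expoI:
  assumes "\<alpha> \<in> supp f" "\<And>\<beta>. \<beta> \<in> supp f \<Longrightarrow> \<beta> \<noteq> \<alpha> \<Longrightarrow> drl_less \<beta> \<alpha>"
  shows "lead_expo f = \<alpha>"
  unfolding lead_expo_def
proof (rule the_equality)
  show "\<alpha>' = \<alpha>" if "\<alpha>' \<in> supp f \<and> (\<forall>\<beta>\<in>supp f. \<beta> \<noteq> \<alpha>' \<longrightarrow> drl_less \<beta> \<alpha>')" for \<alpha>'
    using that assms drl_less_trans[of \<alpha> \<alpha>' \<alpha>] drl_less_irrefl[of \<alpha>] by metis
qed (use assms in auto)

lemma lead_expo: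
  assumes "f \<noteq> 0"
  shows lead_expo_in: "lead_expo f \<in> supp f"
    and lead_expo_max: "\<beta> \<in> supp f \<Longrightarrow> \<beta> \<noteq> lead_expo f \<Longrightarrow> drl_less \<beta> (lead_expo f)"
proof -
  have "supp f \<noteq> {}" using assms by (auto simp: poly_mapping_eq_iff in_keys_iff fun_eq_iff)
  then obtain \<alpha> where \<alpha>: "\<alpha> \<in> supp f" "\<forall>\<beta>\<in>supp f. \<beta> \<noteq> \<alpha> \<longrightarrow> drl_less \<beta> \<alpha>"
    using ex_drl_max[of "supp f"] by auto
  then have "lead_expo f = \<alpha>" by (intro lead_expoI) auto
  then show "lead_expo f \<in> supp f" "\<beta> \<in> supp f \<Longrightarrow> \<beta> \<noteq> lead_expo f \<Longrightarrow> drl_less \<beta> (lead_expo f)"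
    using \<alpha> by auto
qed

lemma tdeg_le_lead_expo: "\<beta> \<in> supp f \<Longrightarrow> tdeg \<beta> \<le> tdeg (lead_expo f)"
  using lead_expo_max[of f \<beta>] by (cases "f = 0"; cases "\<beta> = lead_expo f") (auto simp: drl_less_def)

lemma poly_eq_sum_monomials: "f = (\<Sum>\<alpha>\<in>supp f. monomial (lookup f \<alpha>) \<alpha>)"
  by (rule poly_mapping_eqI)
    (auto simp: lookup_sum lookup_single when_def in_keys_iff sum.delta' cong: if_cong)

lemma lookup_monomial_mult:
  "lookup (monomial c \<gamma> * f) (\<gamma> + \<alpha>) = c * lookup (f :: 'a::comm_ring_1 mpoly) \<alpha>"
proof -
  have "monomial c \<gamma> * f = (\<Sum>\<beta>\<in>supp f. monomial (c * lookup f \<beta>) (\<gamma> + \<beta>))"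
    by (subst poly_eq_sum_monomials[of f]) (simp add: sum_distrib_left mult_single)
  then show ?thesis
    by (auto simp: lookup_sum lookup_single when_def in_keys_iff sum.delta' cong: if_cong)
qed

lemma lookup_const_mult [simp]:
  "lookup (monomial c 0 * f) \<alpha> = c * lookup (f :: 'a::comm_ring_1 mpoly) \<alpha>"
  using lookup_monomial_mult[of 0 c f \<alpha>] by simp

lemma supp_monomial_mult:
  "supp (monomial 1 \<gamma> * f) = (+) \<gamma> ` supp (f :: 'a::comm_ring_1 mpoly)"
proof
  show "supp (monomial 1 \<gamma> * f) \<subseteq> (+) \<gamma> ` supp f"
    using keys_mult[of "monomial 1 \<gamma>" f] by auto
  show "(+) \<gamma> ` supp f \<subseteq> supp (monomial 1 \<gamma> * f)"
    using lookup_monomial_mult[of \<gamma> 1 f] by (auto simp: in_keys_iff)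
qed

lemma lead_expo_monomial_mult:
  assumes "f \<noteq> (0 :: 'a::comm_ring_1 mpoly)"
  shows "lead_expo (monomial 1 \<gamma> * f) = \<gamma> + lead_expo f"
  by (rule lead_expoI)
    (use assms lead_expo_in[of f] lead_expo_max[of f] in
      \<open>auto simp: supp_monomial_mult intro!: drl_less_add_left\<close>)

lemma monomial_eq_0_iff [simp]: "monomial c \<alpha> = 0 \<longleftrightarrow> c = 0"
  by (metis lookup_single_eq lookup_zero single_zero)

text \<open>For an ideal, the exponents of the terms in its leading ideal. Zero is excluded because
  \<open>lead_expo 0\<close> is an unspecified value.\<close>

definition lead_expos :: "'a::zero mpoly set \<Rightarrow> expo set" where
  "lead_expos W = lead_expo ` (W - {0})"

lemma lead_exposE:
  assumes "\<alpha> \<in> lead_expos W"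
  obtains f where "f \<in> W" "f \<noteq> 0" "lead_expo f = \<alpha>"
  using assms by (auto simp: lead_expos_def)

lemma lead_exposI: "f \<in> W \<Longrightarrow> f \<noteq> 0 \<Longrightarrow> lead_expo f \<in> lead_expos W"
  by (auto simp: lead_expos_def)

lemma lead_expos_mono: "V \<subseteq> W \<Longrightarrow> lead_expos V \<subseteq> lead_expos W"
  by (auto simp: lead_expos_def)

section \<open>Linear algebra with leading exponents\<close>

text \<open>Scalars act as constant polynomials, which makes the general notions of span,
  independence and subspace available.\<close>

interpretation mp: vector_space "\<lambda>(c::'k::field) (f::'k mpoly). monomial c 0 * f"
  by unfold_locales
    (auto simp: algebra_simps single_add mult_single simp flip: mult.assoc)

text \<open>In a vanishing combination, the greatest leading exponent among the vectors with nonzero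
  coefficient occurs in only one of them, so nothing can cancel it.\<close>

lemma independent_lead_expo:
  fixes B :: "'k::field mpoly set"
  assumes "finite B" "0 \<notin> B" "inj_on lead_expo B"
  shows "mp.independent B"
proof (rule ccontr)
  assume "\<not> mp.independent B"
  then obtain u where u: "(\<Sum>v\<in>B. monomial (u v) 0 * v) = 0" "\<exists>v\<in>B. u v \<noteq> 0"
    using mp.dependent_finite[OF assms(1)] by auto
  define T where "T = {v\<in>B. u v \<noteq> 0}"
  have "finite (lead_expo ` T)" "lead_expo ` T \<noteq> {}" using u assms by (auto simp: T_def)
  from ex_drl_max[OF this] obtain v where v: "v \<in> T"
    "\<forall>w\<in>T. lead_expo w \<noteq> lead_expo v \<longrightarrow> drl_less (lead_expo w) (lead_expo v)" by blast
  have "u w * lookup w (lead_expo v) = 0" if w: "w \<in> B" "w \<noteq> v" for w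
  proof (cases "w \<in> T")
    case True
    have "lead_expo w \<noteq> lead_expo v" using w v(1) inj_onD[OF assms(3)] by (auto simp: T_def)
    with v(2) True have "drl_less (lead_expo w) (lead_expo v)" by auto
    moreover have "w \<noteq> 0" using w assms by auto
    ultimately have "lead_expo v \<notin> supp w"
      using lead_expo_max[of w "lead_expo v"] drl_less_trans drl_less_irrefl by metis
    then show ?thesis by (simp add: in_keys_iff)
  qed (use w in \<open>auto simp: T_def\<close>)
  then have "(\<Sum>w\<in>B. u w * lookup w (lead_expo v)) = (\<Sum>w\<in>{v}. u w * lookup w (lead_expo v))"
    using v(1) assms(1) by (intro sum.mono_neutral_right) (auto simp: T_def)
  moreover have "(\<Sum>w\<in>B. u w * lookup w (lead_expo v)) = 0"
    using arg_cong[OF u(1), of "\<lambda>f. lookup f (lead_expo v)"] by (simp add: lookup_sum)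
  moreover have "v \<noteq> 0" "u v \<noteq> 0" using v(1) assms by (auto simp: T_def)
  ultimately show False using lead_expo_in[of v] by (simp add: in_keys_iff)
qed

text \<open>Division with remainder, cancelling the greatest reducible exponent first. The
  subtracted part is located in the span of the chosen \<open>g\<close>, not just in
  \<open>W\<close>, so that the lemma also shows that these elements generate
  \<open>W\<close>.\<close>

lemma ex_reduce:
  fixes W :: "'k::field mpoly set"
  assumes M: "finite M" and W: "mp.subspace W" and WM: "\<And>w. w \<in> W \<Longrightarrow> supp w \<subseteq> M"
    and g: "\<And>\<alpha>. \<alpha> \<in> lead_expos W \<Longrightarrow> g \<alpha> \<in> W \<and> g \<alpha> \<noteq> 0 \<and> lead_expo (g \<alpha>) = \<alpha>"
    and f: "supp f \<subseteq> M"
  shows "\<exists>w\<in>mp.span (g ` lead_expos W). supp (f - w) \<subseteq> M - lead_expos W"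
  using f
\<comment> \<open>The measure counts the exponents in \<open>M\<close> at or below some reducible
  exponent of \<open>f\<close>. A reduction step removes \<beta> and leaves only reducible exponents
  below \<beta>.\<close>
proof (induction "card {\<gamma>\<in>M. \<exists>\<beta>\<in>supp f \<inter> lead_expos W. \<gamma> = \<beta> \<or> drl_less \<gamma> \<beta>}"
    arbitrary: f rule: less_induct)
  case less
  show ?case
  proof (cases "supp f \<inter> lead_expos W = {}")
    case True
    then show ?thesis using less.prems mp.span_zero by (intro bexI[of _ 0]) auto
  next
    case False
    then obtain \<beta> where \<beta>: "\<beta> \<in> supp f" "\<beta> \<in> lead_expos W"
      "\<forall>\<gamma>\<in>supp f \<inter> lead_expos W. \<gamma> \<noteq> \<beta> \<longrightarrow> drl_less \<gamma> \<beta>"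
      using ex_drl_max[of "supp f \<inter> lead_expos W"] by auto
    have g\<beta>: "g \<beta> \<in> W" "g \<beta> \<noteq> 0" "lead_expo (g \<beta>) = \<beta>" using g[OF \<beta>(2)] by auto
    define c where "c = lookup f \<beta> / lookup (g \<beta>) \<beta>"
    define f' where "f' = f - monomial c 0 * g \<beta>"
    have c: "c * lookup (g \<beta>) \<beta> = lookup f \<beta>"
      using lead_expo_in[OF g\<beta>(2)] g\<beta>(3) by (simp add: c_def in_keys_iff)
    have sub: "supp f' \<subseteq> supp f \<union> supp (g \<beta>)"
      by (auto simp: f'_def in_keys_iff lookup_minus)
    have nin: "\<beta> \<notin> supp f'" using c by (simp add: f'_def in_keys_iff lookup_minus)
    have f'M: "supp f' \<subseteq> M" using sub less.prems WM[OF g\<beta>(1)] by auto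
    have small: "drl_less \<gamma> \<beta>" if "\<gamma> \<in> supp f' \<inter> lead_expos W" for \<gamma>
    proof (cases "\<gamma> \<in> supp f")
      case True
      then show ?thesis using \<beta>(3) that nin by auto
    next
      case False
      then have "\<gamma> \<in> supp (g \<beta>)" using sub that by auto
      then show ?thesis using lead_expo_max[OF g\<beta>(2)] g\<beta>(3) nin that by auto
    qed
    let ?S = "\<lambda>f. {\<gamma>\<in>M. \<exists>\<beta>\<in>supp f \<inter> lead_expos W. \<gamma> = \<beta> \<or> drl_less \<gamma> \<beta>}"
    have "?S f' \<subseteq> ?S f" using small \<beta>(1,2) drl_less_trans by blast
    moreover have "\<beta> \<in> ?S f" "\<beta> \<notin> ?S f'"
      using \<beta>(1,2) less.prems small drl_less_trans drl_less_irrefl nin by blast+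
    ultimately have "card (?S f') < card (?S f)" using M by (intro psubset_card_mono) auto
    from less.hyps[OF this f'M] obtain w where w: "w \<in> mp.span (g ` lead_expos W)"
      "supp (f' - w) \<subseteq> M - lead_expos W" by blast
    have "monomial c 0 * g \<beta> + w \<in> mp.span (g ` lead_expos W)"
      by (intro mp.span_add mp.span_scale w(1)) (intro mp.span_base imageI \<beta>(2))
    moreover have "f - (monomial c 0 * g \<beta> + w) = f' - w" by (simp add: f'_def)
    ultimately show ?thesis using w(2) by metis
  qed
qed

lemma supp_disjoint_lead_expos:
  assumes "f \<in> W" "supp f \<inter> lead_expos W = {}"
  shows "f = 0"
  using assms lead_expo_in[of f] lead_exposI[of f W] by auto

lemma lead_expos_subset: "(\<And>w. w \<in> W \<Longrightarrow> supp w \<subseteq> M) \<Longrightarrow> lead_expos W \<subseteq> M"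
  using lead_expo_in by (auto simp: lead_expos_def)

lemma ex_normal_form:
  fixes W :: "'k::field mpoly set"
  assumes M: "finite M" and W: "mp.subspace W" and WM: "\<And>w. w \<in> W \<Longrightarrow> supp w \<subseteq> M"
    and f: "supp f \<subseteq> M"
  shows "\<exists>w\<in>W. supp (f - w) \<subseteq> M - lead_expos W"
proof -
  have "\<forall>\<alpha>\<in>lead_expos W. \<exists>g. g \<in> W \<and> g \<noteq> 0 \<and> lead_expo g = \<alpha>" by (auto elim: lead_exposE)
  then obtain g where g: "\<And>\<alpha>. \<alpha> \<in> lead_expos W \<Longrightarrow> g \<alpha> \<in> W \<and> g \<alpha> \<noteq> 0 \<and> lead_expo (g \<alpha>) = \<alpha>"
    by metis
  have "mp.span (g ` lead_expos W) \<subseteq> W" using g by (intro mp.span_minimal[OF _ W]) auto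
  then show ?thesis using ex_reduce[OF M W WM g f] by blast
qed

text \<open>One element is chosen per leading exponent. They are independent as their leading
  exponents differ, and they generate \<open>W\<close> because the remainder of an element of
  \<open>W\<close> stays in \<open>W\<close> and has no reducible exponent, hence is zero.\<close>

lemma ex_basis_lead_expos:
  fixes W :: "'k::field mpoly set"
  assumes M: "finite M" and W: "mp.subspace W" and WM: "\<And>w. w \<in> W \<Longrightarrow> supp w \<subseteq> M"
  obtains B where "finite B" "B \<subseteq> W" "W \<subseteq> mp.span B" "mp.independent B" "card B = card (lead_expos W)"
proof -
  have "\<forall>\<alpha>\<in>lead_expos W. \<exists>g. g \<in> W \<and> g \<noteq> 0 \<and> lead_expo g = \<alpha>" by (auto elim: lead_exposE)
  then obtain g where g: "\<And>\<alpha>. \<alpha> \<in> lead_expos W \<Longrightarrow> g \<alpha> \<in> W \<and> g \<alpha> \<noteq> 0 \<and> lead_expo (g \<alpha>) = \<alpha>"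
    by metis
  have fin: "finite (lead_expos W)" using lead_expos_subset[of W M, OF WM] M by (rule finite_subset)
  have inj: "inj_on g (lead_expos W)" by (rule inj_on_inverseI[of _ lead_expo]) (use g in auto)
  have sub: "mp.span (g ` lead_expos W) \<subseteq> W" using g by (intro mp.span_minimal[OF _ W]) auto
  have span: "W \<subseteq> mp.span (g ` lead_expos W)"
  proof
    fix f assume f: "f \<in> W"
    then obtain w where w: "w \<in> mp.span (g ` lead_expos W)" "supp (f - w) \<subseteq> M - lead_expos W"
      using ex_reduce[OF M W WM g WM] by blast
    then have "f - w \<in> W" using f sub mp.subspace_diff[OF W] by blast
    then have "f - w = 0" using w(2) by (intro supp_disjoint_lead_expos[of _ W]) auto
    then show "f \<in> mp.span (g ` lead_expos W)" using w(1) by simp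
  qed
  have "mp.independent (g ` lead_expos W)"
    using g fin by (intro independent_lead_expo inj_onI) fastforce+
  then show ?thesis
    using that[of "g ` lead_expos W"] fin g span card_image[OF inj] by auto
qed

text \<open>By \<open>ind\<close> the family \<open>a\<close> is independent modulo
  \<open>J\<close>, so adjoining it to a basis of \<open>J\<close> gives an independent set inside
  \<open>W\<close>.\<close>

lemma card_lead_expos_add_le:
  fixes W :: "'k::field mpoly set"
  assumes M: "finite M" and W: "mp.subspace W" and WM: "\<And>w. w \<in> W \<Longrightarrow> supp w \<subseteq> M"
    and J: "mp.subspace J" "J \<subseteq> W" and X: "finite X" "\<And>x. x \<in> X \<Longrightarrow> a x \<in> W"
    and ind: "\<And>c. (\<Sum>x\<in>X. monomial (c x) 0 * a x) \<in> J \<Longrightarrow> \<forall>x\<in>X. c x = 0"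
  shows "card X + card (lead_expos J) \<le> card (lead_expos W)"
proof -
  obtain B where B: "finite B" "B \<subseteq> J" "J \<subseteq> mp.span B" "mp.independent B"
    "card B = card (lead_expos J)"
    using ex_basis_lead_expos[OF M J(1)] J(2) WM by blast
  obtain T where T: "finite T" "T \<subseteq> W" "W \<subseteq> mp.span T" "mp.independent T"
    "card T = card (lead_expos W)"
    using ex_basis_lead_expos[OF M W WM] by blast
  have inj: "inj_on a X"
  proof (rule inj_onI, rule ccontr)
    fix x y assume xy: "x \<in> X" "y \<in> X" "a x = a y" "x \<noteq> y"
    \<comment> \<open>Coefficients 1 and -1 at two indices with the same value would be a nontrivial
      relation.\<close>
    let ?c = "\<lambda>z. if z = x then 1 else if z = y then - 1 else 0 :: 'k"
    have "(\<Sum>z\<in>X. monomial (?c z) 0 * a z) = (\<Sum>z\<in>{x,y}. monomial (?c z) 0 * a z)"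
      using xy X by (intro sum.mono_neutral_right) auto
    also have "\<dots> = 0" using xy by (simp add: single_uminus)
    finally have "\<forall>z\<in>X. ?c z = 0" using mp.subspace_0[OF J(1)] by (intro ind) simp
    then show False using xy(1) by auto
  qed
  have disj: "a ` X \<inter> B = {}"
  proof (rule ccontr)
    assume "a ` X \<inter> B \<noteq> {}"
    then obtain x where x: "x \<in> X" "a x \<in> J" using B by blast
    let ?c = "\<lambda>z. if z = x then 1 else 0 :: 'k"
    have "(\<Sum>z\<in>X. monomial (?c z) 0 * a z) = (\<Sum>z\<in>{x}. monomial (?c z) 0 * a z)"
      using x X by (intro sum.mono_neutral_right) auto
    also have "\<dots> = a x" by simp
    finally have "\<forall>z\<in>X. ?c z = 0" using x by (intro ind) simp
    then show False using x(1) by auto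
  qed
  have "mp.independent (a ` X \<union> B)"
  proof (rule ccontr)
    assume "\<not> mp.independent (a ` X \<union> B)"
    then obtain u where u: "(\<Sum>v\<in>a ` X \<union> B. monomial (u v) 0 * v) = 0" "\<exists>v\<in>a ` X \<union> B. u v \<noteq> 0"
      using mp.dependent_finite[of "a ` X \<union> B"] X B by auto
    have "(\<Sum>v\<in>a ` X \<union> B. monomial (u v) 0 * v)
        = (\<Sum>v\<in>a ` X. monomial (u v) 0 * v) + (\<Sum>v\<in>B. monomial (u v) 0 * v)"
      using disj X B by (intro sum.union_disjoint) auto
    also have "(\<Sum>v\<in>a ` X. monomial (u v) 0 * v) = (\<Sum>x\<in>X. monomial (u (a x)) 0 * a x)"
      using inj by (simp add: sum.reindex)
    finally have eq: "(\<Sum>x\<in>X. monomial (u (a x)) 0 * a x) = - (\<Sum>v\<in>B. monomial (u v) 0 * v)"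
      using u(1) by (simp add: eq_neg_iff_add_eq_0)
    have "- (\<Sum>v\<in>B. monomial (u v) 0 * v) \<in> J"
      using B(2) by (intro mp.subspace_neg mp.subspace_sum mp.subspace_scale J(1)) auto
    with eq have X0: "\<forall>x\<in>X. u (a x) = 0" by (intro ind) simp
    then have "(\<Sum>v\<in>B. monomial (u v) 0 * v) = 0" using eq by simp
    then have "\<forall>v\<in>B. u v = 0" using B mp.dependent_finite[of B] by auto
    then show False using X0 u(2) by auto
  qed
  moreover have "a ` X \<union> B \<subseteq> mp.span T" using X T B J by blast
  ultimately have "card (a ` X \<union> B) \<le> card T" using mp.independent_span_bound[OF T(1)] by auto
  then show ?thesis
    using T(5) B(5) disj card_Un_disjoint[of "a ` X" B] X(1) B(1) card_image[OF inj] by simp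
qed

text \<open>A basis of \<open>J\<close> together with \<open>X\<close> generates all of
  \<open>W\<close>, and independent sets are no larger than generating ones.\<close>

lemma card_lead_expos_le:
  fixes W :: "'k::field mpoly set"
  assumes M: "finite M" and W: "mp.subspace W" and WM: "\<And>w. w \<in> W \<Longrightarrow> supp w \<subseteq> M"
    and J: "mp.subspace J" "\<And>w. w \<in> J \<Longrightarrow> supp w \<subseteq> M" and X: "finite X" "W \<subseteq> mp.span (J \<union> X)"
  shows "card (lead_expos W) \<le> card (lead_expos J) + card X"
proof -
  obtain B where B: "finite B" "B \<subseteq> J" "J \<subseteq> mp.span B" "mp.independent B"
    "card B = card (lead_expos J)"
    using ex_basis_lead_expos[OF M J] by blast
  obtain T where T: "finite T" "T \<subseteq> W" "W \<subseteq> mp.span T" "mp.independent T"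
    "card T = card (lead_expos W)"
    using ex_basis_lead_expos[OF M W WM] by blast
  have "J \<union> X \<subseteq> mp.span (B \<union> X)"
    using B(3) mp.span_mono[of B "B \<union> X"] mp.span_superset[of "B \<union> X"] by blast
  then have "W \<subseteq> mp.span (B \<union> X)" using X mp.span_minimal[OF _ mp.subspace_span] by blast
  then have "card T \<le> card (B \<union> X)"
    using mp.independent_span_bound[of "B \<union> X" T] T B X by auto
  also have "\<dots> \<le> card B + card X" by (rule card_Un_le)
  finally show ?thesis using T B by simp
qed

section \<open>Ideals and standard terms\<close>

definition exps :: "nat \<Rightarrow> expo set" where
  "exps n = {\<alpha>. vars \<alpha> \<subseteq> {1..n}}"

definition terms :: "nat \<Rightarrow> nat \<Rightarrow> expo set" where
  "terms n d = {\<alpha> \<in> exps n. tdeg \<alpha> \<le> d}"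

lemma mem_carrier_iff: "f \<in> carrier (poly_ring n) \<longleftrightarrow> supp f \<subseteq> exps n"
  by (auto simp: poly_ring_def polys_over_def exps_def)

lemma exps_add_iff [simp]: "\<alpha> + \<beta> \<in> exps n \<longleftrightarrow> \<alpha> \<in> exps n \<and> \<beta> \<in> exps n"
  by (auto simp: exps_def vars_add)

lemma zero_in_exps [simp]: "0 \<in> exps n"
  by (simp add: exps_def)

lemma poly_ring_simps [simp]:
  "\<zero>\<^bsub>poly_ring n\<^esub> = (0 :: 'a::comm_ring_1 mpoly)"
  "\<one>\<^bsub>poly_ring n\<^esub> = (1 :: 'a mpoly)"
  "f \<oplus>\<^bsub>poly_ring n\<^esub> g = (f + g :: 'a mpoly)"
  "f \<otimes>\<^bsub>poly_ring n\<^esub> g = (f * g :: 'a mpoly)"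
  by (simp_all add: poly_ring_def)

section \<open>Ideals of the polynomial ring in terms of ordinary polynomial arithmetic\<close>

context
  fixes n :: nat
begin

interpretation R: cring "poly_ring n :: 'a::comm_ring_1 mpoly ring"
  by (rule cring_poly_ring)

lemma poly_ring_a_inv [simp]:
  assumes "f \<in> carrier (poly_ring n)"
  shows "\<ominus>\<^bsub>poly_ring n\<^esub> f = (- f :: 'a::comm_ring_1 mpoly)"
proof -
  have "- f \<in> carrier (poly_ring n)" using assms by (simp add: mem_carrier_iff)
  then show ?thesis using R.minus_equality[of "- f" f] assms by simp
qed

lemma carrier_add: "f \<in> carrier (poly_ring n) \<Longrightarrow> g \<in> carrier (poly_ring n) \<Longrightarrow>
    (f + g :: 'a::comm_ring_1 mpoly) \<in> carrier (poly_ring n)"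
  using R.a_closed by simp

lemma carrier_mult: "f \<in> carrier (poly_ring n) \<Longrightarrow> g \<in> carrier (poly_ring n) \<Longrightarrow>
    (f * g :: 'a::comm_ring_1 mpoly) \<in> carrier (poly_ring n)"
  using R.m_closed by simp

text \<open>Negatives come from multiplication by -1, and left multiples suffice by
  commutativity.\<close>

lemma poly_ring_idealI:
  fixes J :: "'a::comm_ring_1 mpoly set"
  assumes "J \<subseteq> carrier (poly_ring n)" "0 \<in> J" "\<And>f g. f \<in> J \<Longrightarrow> g \<in> J \<Longrightarrow> f + g \<in> J"
    and mult: "\<And>f p. f \<in> J \<Longrightarrow> p \<in> carrier (poly_ring n) \<Longrightarrow> p * f \<in> J"
  shows "ideal J (poly_ring n)"
proof (rule idealI)
  show "subgroup J (add_monoid (poly_ring n))"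
  proof
    fix f assume f: "f \<in> J"
    have "- f \<in> J" using mult[OF f, of "- 1"] by (simp add: mem_carrier_iff)
    then have "\<ominus>\<^bsub>poly_ring n\<^esub> f \<in> J" using f assms(1) by (simp add: subset_iff)
    then show "inv\<^bsub>add_monoid (poly_ring n)\<^esub> f \<in> J" by (simp add: a_inv_def)
  qed (use assms in auto)
qed (use assms R.ring_axioms in \<open>auto simp: mult.commute\<close>)

context
  fixes J :: "'a::comm_ring_1 mpoly set"
  assumes J: "ideal J (poly_ring n)"
begin

interpretation J: ideal J "poly_ring n" by (rule J)

lemma ideal_carrier: "f \<in> J \<Longrightarrow> f \<in> carrier (poly_ring n)"
  using J.a_subset by blast

lemma ideal_supp: "f \<in> J \<Longrightarrow> supp f \<subseteq> exps n"
  using ideal_carrier mem_carrier_iff by blast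

lemma ideal_0: "0 \<in> J"
  using J.zero_closed by simp

lemma ideal_add: "f \<in> J \<Longrightarrow> g \<in> J \<Longrightarrow> f + g \<in> J"
  using J.a_closed by simp

lemma ideal_mult: "f \<in> J \<Longrightarrow> p \<in> carrier (poly_ring n) \<Longrightarrow> p * f \<in> J"
  using J.I_l_closed by simp

lemma ideal_uminus: "f \<in> J \<Longrightarrow> - f \<in> J"
  using ideal_mult[of f "- 1"] by (simp add: mem_carrier_iff)

lemma ideal_diff: "f \<in> J \<Longrightarrow> g \<in> J \<Longrightarrow> f - g \<in> J"
  using ideal_add[of f "- g"] ideal_uminus by simp

lemma ideal_sum: "(\<And>x. x \<in> X \<Longrightarrow> f x \<in> J) \<Longrightarrow> sum f X \<in> J"
  by (induction X rule: infinite_finite_induct) (auto simp: ideal_0 intro: ideal_add)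

end

end

lemma monomial_carrier [simp]: "\<alpha> \<in> exps n \<Longrightarrow> monomial c \<alpha> \<in> carrier (poly_ring n)"
  by (simp add: mem_carrier_iff)

text \<open>Multiplying by a term shifts the leading exponent, so leading exponents behave like
  those of a monomial ideal.\<close>

lemma lead_expos_ideal_add:
  fixes J :: "'a::comm_ring_1 mpoly set"
  assumes "ideal J (poly_ring n)" "\<alpha> \<in> lead_expos J" "\<gamma> \<in> exps n"
  shows "\<gamma> + \<alpha> \<in> lead_expos J"
proof -
  obtain f where f: "f \<in> J" "f \<noteq> 0" "lead_expo f = \<alpha>" using assms(2) by (rule lead_exposE)
  have "monomial 1 \<gamma> * f \<noteq> 0"
    using lead_expo_in[OF f(2)] supp_monomial_mult[of \<gamma> f] by auto
  then show ?thesis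
    using lead_expo_monomial_mult[OF f(2), of \<gamma>] f ideal_mult[OF assms(1) f(1), of "monomial 1 \<gamma>"]
      lead_exposI[of "monomial 1 \<gamma> * f" J] assms(3) by simp
qed

text \<open>Embeds exponent vectors into functions on a finite set, which gives finiteness and the
  counting of boxes.\<close>

lemma inj_on_restrict_lookup: "inj_on (\<lambda>\<alpha>. restrict (lookup \<alpha>) {1..n}) (exps n)"
proof (rule inj_onI, rule poly_mapping_eqI)
  fix \<alpha> \<beta> i
  assume *: "\<alpha> \<in> exps n" "\<beta> \<in> exps n" "restrict (lookup \<alpha>) {1..n} = restrict (lookup \<beta>) {1..n}"
  show "lookup \<alpha> i = lookup \<beta> i"
  proof (cases "i \<in> {1..n}")
    case True
    then show ?thesis using fun_cong[OF *(3), of i] by (simp del: One_nat_def)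
  next
    case False
    then have "i \<notin> vars \<alpha>" "i \<notin> vars \<beta>" using * unfolding exps_def by blast+
    then show ?thesis by (simp add: in_keys_iff)
  qed
qed

lemma finite_terms [simp]: "finite (terms n d)"
proof (rule inj_on_finite)
  show "inj_on (\<lambda>\<alpha>. restrict (lookup \<alpha>) {1..n}) (terms n d)"
    by (rule inj_on_subset[OF inj_on_restrict_lookup]) (auto simp: terms_def)
  show "(\<lambda>\<alpha>. restrict (lookup \<alpha>) {1..n}) ` terms n d \<subseteq> {1..n} \<rightarrow>\<^sub>E {..d}"
    using order_trans[OF lookup_le_tdeg] by (auto simp: terms_def)
qed (intro finite_PiE, auto)

lemma terms_mono: "d \<le> e \<Longrightarrow> terms n d \<subseteq> terms n e"
  by (auto simp: terms_def)

text \<open>Over a field and for an ideal \<open>J\<close>, this is the affine Hilbert function of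
  the quotient by \<open>J\<close>.\<close>

definition std_count :: "nat \<Rightarrow> 'a::comm_ring_1 mpoly set \<Rightarrow> nat \<Rightarrow> nat" where
  "std_count n J d = card (terms n d - lead_expos J)"

text \<open>The finite-dimensional piece of an ideal to which the linear algebra above
  applies.\<close>

definition trunc_ideal :: "nat \<Rightarrow> 'a::comm_ring_1 mpoly set \<Rightarrow> nat \<Rightarrow> 'a mpoly set" where
  "trunc_ideal n J d = {f \<in> J. supp f \<subseteq> terms n d}"

text \<open>Degree compatibility of the order: if the leading term has degree at most
  \<open>d\<close>, so have all other terms.\<close>

lemma lead_expos_trunc_ideal:
  assumes "ideal J (poly_ring n)"
  shows "lead_expos (trunc_ideal n J d) = lead_expos J \<inter> terms n d"
proof (intro equalityI subsetI)
  fix \<alpha> assume "\<alpha> \<in> lead_expos J \<inter> terms n d"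
  then obtain f where f: "f \<in> J" "f \<noteq> 0" "lead_expo f = \<alpha>" "\<alpha> \<in> terms n d" by (auto elim: lead_exposE)
  have "\<beta> \<in> terms n d" if "\<beta> \<in> supp f" for \<beta>
    using tdeg_le_lead_expo[OF that] f(3,4) ideal_supp[OF assms f(1)] that by (auto simp: terms_def)
  then show "\<alpha> \<in> lead_expos (trunc_ideal n J d)"
    using f lead_exposI[of f "trunc_ideal n J d"] by (auto simp: trunc_ideal_def)
qed (auto simp: trunc_ideal_def elim!: lead_exposE intro: lead_exposI dest: lead_expo_in)

lemma card_lead_expos_trunc_ideal:
  assumes "ideal J (poly_ring n)"
  shows "card (lead_expos (trunc_ideal n J d)) + std_count n J d = card (terms n d)"
proof -
  have "card (terms n d) = card (terms n d \<inter> lead_expos J) + card (terms n d - lead_expos J)"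
    by (rule card_Int_Diff) simp
  then show ?thesis
    by (simp add: lead_expos_trunc_ideal[OF assms] std_count_def Int_commute)
qed

lemma subspace_ideal:
  fixes J :: "'k::field mpoly set"
  assumes "ideal J (poly_ring n)"
  shows "mp.subspace J"
  using assms by (intro mp.subspaceI) (auto intro: ideal_0 ideal_add ideal_mult)

lemma subspace_supp: "mp.subspace {f :: 'k::field mpoly. supp f \<subseteq> M}"
proof (intro mp.subspaceI)
  show "f + g \<in> {f. supp f \<subseteq> M}" if "f \<in> {f. supp f \<subseteq> M}" "g \<in> {f. supp f \<subseteq> M}" for f g :: "'k mpoly"
    using that Poly_Mapping.keys_add[of f g] by auto
qed (auto simp: in_keys_iff)

lemma subspace_trunc_ideal:
  fixes J :: "'k::field mpoly set"
  assumes "ideal J (poly_ring n)"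
  shows "mp.subspace (trunc_ideal n J d)"
proof -
  have "trunc_ideal n J d = J \<inter> {f. supp f \<subseteq> terms n d}" by (auto simp: trunc_ideal_def)
  then show ?thesis using mp.subspace_inter[OF subspace_ideal[OF assms] subspace_supp] by simp
qed

lemma std_count_mono: "d \<le> e \<Longrightarrow> std_count n J d \<le> std_count n J e"
  unfolding std_count_def using terms_mono[of d e n] by (intro card_mono) auto

lemma std_count_antimono: "J \<subseteq> K \<Longrightarrow> std_count n K d \<le> std_count n J d"
  unfolding std_count_def using lead_expos_mono[of J K] by (intro card_mono) auto

lemma lookup_sum_monomials:
  assumes "finite X"
  shows "lookup (\<Sum>x\<in>X. monomial (c x) x) \<alpha> = (if \<alpha> \<in> X then c \<alpha> else 0)"
  using assms by (auto simp: lookup_sum lookup_single when_def sum.delta' cong: if_cong)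

text \<open>The products of \<open>f\<close> with the terms of degree at most \<open>d - e\<close>
  that are standard for \<open>p\<close> lie in \<open>q\<close> and are independent modulo
  \<open>p\<close>: a relation puts some \<open>g * f\<close> into \<open>p\<close>, primality puts
  \<open>g\<close> into \<open>p\<close>, and a combination of standard terms lying in
  \<open>p\<close> is zero.\<close>

lemma std_count_prime_less:
  fixes p q :: "'k::field mpoly set"
  assumes p: "primeideal p (poly_ring n)" and q: "ideal q (poly_ring n)" and "p \<subseteq> q"
    and f: "f \<in> q" "f \<notin> p" "supp f \<subseteq> terms n e" and "e \<le> d"
  shows "std_count n q d + std_count n p (d - e) \<le> std_count n p d"
proof -
  interpret p: primeideal p "poly_ring n" by (rule p)
  have pi: "ideal p (poly_ring n)" by (rule p.is_ideal)
  define X where "X = terms n (d - e) - lead_expos p"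
  have X: "finite X" by (simp add: X_def)
  have fc: "f \<in> carrier (poly_ring n)" using q f(1) by (rule ideal_carrier)
  have "card X + card (lead_expos (trunc_ideal n p d)) \<le> card (lead_expos (trunc_ideal n q d))"
  proof (rule card_lead_expos_add_le[where a = "\<lambda>x. monomial 1 x * f" and M = "terms n d"])
    show "trunc_ideal n p d \<subseteq> trunc_ideal n q d" using \<open>p \<subseteq> q\<close> by (auto simp: trunc_ideal_def)
    show "monomial 1 x * f \<in> trunc_ideal n q d" if "x \<in> X" for x
    proof -
      have x: "x \<in> exps n" "tdeg x \<le> d - e" using that by (auto simp: X_def terms_def)
      have "supp (monomial 1 x * f) \<subseteq> terms n d"
        using f(3) x \<open>e \<le> d\<close> by (fastforce simp: supp_monomial_mult terms_def tdeg_add)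
      then show ?thesis using ideal_mult[OF q f(1)] x by (simp add: trunc_ideal_def)
    qed
    fix c assume *: "(\<Sum>x\<in>X. monomial (c x) 0 * (monomial 1 x * f)) \<in> trunc_ideal n p d"
    define g where "g = (\<Sum>x\<in>X. monomial (c x) x)"
    have lg: "lookup g \<alpha> = (if \<alpha> \<in> X then c \<alpha> else 0)" for \<alpha>
      unfolding g_def by (rule lookup_sum_monomials[OF X])
    then have supp_g: "supp g \<subseteq> X" by (auto simp: in_keys_iff split: if_splits)
    then have gc: "g \<in> carrier (poly_ring n)" by (auto simp: mem_carrier_iff X_def terms_def)
    have "(\<Sum>x\<in>X. monomial (c x) 0 * (monomial 1 x * f)) = g * f"
      by (simp add: g_def sum_distrib_right mult_single flip: mult.assoc)
    then have "g * f \<in> p" using * by (simp add: trunc_ideal_def)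
    then have "g \<in> p" using p.I_prime[OF gc fc] f(2) by simp
    then have "g = 0" using supp_g by (intro supp_disjoint_lead_expos[of g p]) (auto simp: X_def)
    then show "\<forall>x\<in>X. c x = 0" using lg by (metis lookup_zero)
  qed (use X pi q subspace_trunc_ideal in \<open>auto simp: trunc_ideal_def\<close>)
  then show ?thesis
    using card_lead_expos_trunc_ideal[OF pi, of d] card_lead_expos_trunc_ideal[OF q, of d]
    by (simp add: X_def std_count_def)
qed

section \<open>Homogeneous components\<close>

text \<open>Homogeneous components and truncation by degree are both instances of this
  projection.\<close>

definition restr :: "(expo \<Rightarrow> bool) \<Rightarrow> 'a::comm_ring_1 mpoly \<Rightarrow> 'a mpoly" where
  "restr P f = (\<Sum>\<alpha>\<in>{\<alpha>\<in>supp f. P \<alpha>}. monomial (lookup f \<alpha>) \<alpha>)"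

lemma lookup_restr [simp]: "lookup (restr P f) \<alpha> = (if P \<alpha> then lookup f \<alpha> else 0)"
  unfolding restr_def by (subst lookup_sum_monomials) (auto simp: in_keys_iff)

lemma supp_restr: "supp (restr P f) = {\<alpha> \<in> supp f. P \<alpha>}"
  by (auto simp: in_keys_iff split: if_splits)

lemma restr_add: "restr P (f + g) = restr P f + restr P g"
  by (rule poly_mapping_eqI) (simp add: lookup_add)

lemma restr_sum: "restr P (sum f X) = (\<Sum>x\<in>X. restr P (f x))"
  by (rule poly_mapping_eqI) (simp add: lookup_sum)

lemma restr_0 [simp]: "restr P 0 = 0"
  by (rule poly_mapping_eqI) simp

lemma restr_eq_self: "(\<And>\<alpha>. \<alpha> \<in> supp f \<Longrightarrow> P \<alpha>) \<Longrightarrow> restr P f = f"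
  by (rule poly_mapping_eqI) (auto simp: in_keys_iff)

lemma restr_eq_0: "(\<And>\<alpha>. \<alpha> \<in> supp f \<Longrightarrow> \<not> P \<alpha>) \<Longrightarrow> restr P f = 0"
  by (rule poly_mapping_eqI) (auto simp: in_keys_iff)

lemma restr_carrier: "f \<in> carrier (poly_ring n) \<Longrightarrow> restr P f \<in> carrier (poly_ring n)"
  by (auto simp: mem_carrier_iff supp_restr)

abbreviation hcomp :: "nat \<Rightarrow> 'a::comm_ring_1 mpoly \<Rightarrow> 'a mpoly" where
  "hcomp d \<equiv> restr (\<lambda>\<alpha>. tdeg \<alpha> = d)"

lemma homogeneous_hcomp: "homogeneous_of d (hcomp d f)"
  by (simp add: homogeneous_of_def supp_restr)

lemma homogeneous_of_mult:
  "homogeneous_of d f \<Longrightarrow> homogeneous_of e g \<Longrightarrow> homogeneous_of (d + e) (f * g :: 'a::comm_ring_1 mpoly)"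
  using keys_mult[of f g] by (fastforce simp: homogeneous_of_def tdeg_add)

lemma hcomp_homogeneous:
  "homogeneous_of e f \<Longrightarrow> hcomp d f = (if d = e then f else 0)"
  by (auto simp: homogeneous_of_def intro: restr_eq_self restr_eq_0)

lemma restr_tdeg_le_eq_sum: "restr (\<lambda>\<alpha>. tdeg \<alpha> \<le> d) f = (\<Sum>i\<le>d. hcomp i f)"
  by (rule poly_mapping_eqI) (auto simp: lookup_sum sum.delta cong: if_cong)

lemma eq_sum_hcomp:
  assumes "supp f \<subseteq> terms n d"
  shows "f = (\<Sum>i\<le>d. hcomp i f)"
  using assms by (subst restr_tdeg_le_eq_sum[symmetric], subst restr_eq_self) (auto simp: terms_def)

lemma supp_subset_terms:
  assumes "f \<in> carrier (poly_ring n)"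
  shows "supp f \<subseteq> terms n (tdeg (lead_expo f))"
  using assms tdeg_le_lead_expo by (auto simp: mem_carrier_iff terms_def)

lemma hcomp_mult:
  assumes "f \<in> carrier (poly_ring n)" "g \<in> carrier (poly_ring n)"
  shows "hcomp k (f * g) = (\<Sum>i\<le>k. hcomp i f * hcomp (k - i) (g :: 'a::comm_ring_1 mpoly))"
proof -
  \<comment> \<open>A common bound for both degrees, at least \<open>k\<close> so that every index
    contributing to degree \<open>k\<close> is in range.\<close>
  define d where "d = max k (max (tdeg (lead_expo f)) (tdeg (lead_expo g)))"
  have f: "f = (\<Sum>i\<le>d. hcomp i f)"
    by (rule eq_sum_hcomp[of f n], rule order_trans[OF supp_subset_terms[OF assms(1)] terms_mono])
      (simp add: d_def)
  have g: "g = (\<Sum>i\<le>d. hcomp i g)"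
    by (rule eq_sum_hcomp[of g n], rule order_trans[OF supp_subset_terms[OF assms(2)] terms_mono])
      (simp add: d_def)
  have "hcomp k (f * g) = hcomp k (\<Sum>i\<le>d. \<Sum>j\<le>d. hcomp i f * hcomp j g)"
    unfolding sum_product[symmetric] by (rule arg_cong2[OF f g, of "\<lambda>f g. hcomp k (f * g)"])
  also have "\<dots> = (\<Sum>i\<le>d. \<Sum>j\<le>d. if k = i + j then hcomp i f * hcomp j g else 0)"
    unfolding restr_sum
    by (intro sum.cong refl hcomp_homogeneous homogeneous_of_mult homogeneous_hcomp)
  also have "\<dots> = (\<Sum>i\<le>d. if i \<le> k then hcomp i f * hcomp (k - i) g else 0)"
  proof (intro sum.cong refl)
    fix i
    have "(\<Sum>j\<le>d. if k = i + j then hcomp i f * hcomp j g else 0)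
      = (\<Sum>j\<le>d. if j = k - i then if i \<le> k then hcomp i f * hcomp (k - i) g else 0 else 0)"
      by (intro sum.cong refl) auto
    then show "(\<Sum>j\<le>d. if k = i + j then hcomp i f * hcomp j g else 0)
      = (if i \<le> k then hcomp i f * hcomp (k - i) g else 0)"
      using diff_le_self[of k i] by (auto simp: sum.delta d_def intro: order_trans max.cobounded1)
  qed
  also have "\<dots> = (\<Sum>i\<le>k. hcomp i f * hcomp (k - i) g)"
    by (intro sum.mono_neutral_cong_right) (auto simp: d_def)
  finally show ?thesis .
qed

section \<open>Graded ideals\<close>

definition graded :: "'a::comm_ring_1 mpoly set \<Rightarrow> bool" where
  "graded J \<longleftrightarrow> (\<forall>f\<in>J. \<forall>d. hcomp d f \<in> J)"

text \<open>The elements of \<open>I\<close> whose components all stay in \<open>I\<close> form an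
  ideal containing the homogeneous generators, hence all of \<open>I\<close>.\<close>

lemma homogeneous_ideal_graded:
  fixes I :: "'a::comm_ring_1 mpoly set"
  assumes "homogeneous_ideal n I"
  shows "graded I"
proof -
  interpret R: cring "poly_ring n :: 'a mpoly ring" by (rule cring_poly_ring)
  obtain S where S: "S \<subseteq> carrier (poly_ring n)" "\<forall>f\<in>S. homogeneous f" "I = Idl\<^bsub>poly_ring n\<^esub> S"
    using assms by (auto simp: homogeneous_ideal_def)
  have I: "ideal I (poly_ring n)" unfolding S(3) by (rule R.genideal_ideal[OF S(1)])
  define K where "K = {f \<in> I. \<forall>d. hcomp d f \<in> I}"
  have "ideal K (poly_ring n)"
  proof (rule poly_ring_idealI)
    fix f p :: "'a mpoly" assume f: "f \<in> K" and p: "p \<in> carrier (poly_ring n)"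
    then have fI: "f \<in> I" and fI': "hcomp d f \<in> I" for d by (auto simp: K_def)
    have "hcomp d (p * f) \<in> I" for d
      unfolding hcomp_mult[OF p ideal_carrier[OF I fI]]
      by (intro ideal_sum[OF I] ideal_mult[OF I fI'] restr_carrier p)
    then show "p * f \<in> K" using ideal_mult[OF I fI p] by (simp add: K_def)
  qed (use I in \<open>auto simp: K_def restr_add intro: ideal_carrier ideal_0 ideal_add\<close>)
  moreover have "S \<subseteq> K"
  proof
    fix f assume "f \<in> S"
    moreover from this obtain e where "homogeneous_of e f" using S by (auto simp: homogeneous_def)
    ultimately show "f \<in> K"
      using R.genideal_self[OF S(1)] ideal_0[OF I]
      by (auto simp: K_def S(3) hcomp_homogeneous)
  qed
  ultimately have "I \<subseteq> K" unfolding S(3) by (rule R.genideal_minimal)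
  then show ?thesis by (auto simp: K_def graded_def)
qed

lemma graded_restr_tdeg_le:
  assumes "graded J" "ideal J (poly_ring n)" "f \<in> J"
  shows "restr (\<lambda>\<alpha>. tdeg \<alpha> \<le> d) f \<in> J"
  unfolding restr_tdeg_le_eq_sum using assms by (intro ideal_sum) (auto simp: graded_def)

text \<open>Multiplication by a term raises all degrees by the same amount, so it keeps the low and
  the high part of \<open>f\<close> apart.\<close>

lemma restr_monomial_mult:
  "restr (\<lambda>\<alpha>. tdeg \<alpha> \<le> tdeg \<xi> + d) (monomial 1 \<xi> * f)
    = monomial 1 \<xi> * restr (\<lambda>\<alpha>. tdeg \<alpha> \<le> d) (f :: 'a::comm_ring_1 mpoly)"
proof -
  let ?P = "\<lambda>\<alpha>. tdeg \<alpha> \<le> tdeg \<xi> + d"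
  define a where "a = restr (\<lambda>\<alpha>. tdeg \<alpha> \<le> d) f"
  define b where "b = restr (\<lambda>\<alpha>. \<not> tdeg \<alpha> \<le> d) f"
  have f: "f = a + b" by (rule poly_mapping_eqI) (simp add: lookup_add a_def b_def)
  have "restr ?P (monomial 1 \<xi> * a) = monomial 1 \<xi> * a"
    by (rule restr_eq_self) (auto simp: supp_monomial_mult tdeg_add a_def supp_restr)
  moreover have "restr ?P (monomial 1 \<xi> * b) = 0"
    by (rule restr_eq_0) (auto simp: supp_monomial_mult tdeg_add b_def supp_restr)
  ultimately have "restr ?P (monomial 1 \<xi> * f) = monomial 1 \<xi> * a"
    by (simp add: f distrib_left restr_add)
  then show ?thesis by (simp add: a_def)
qed

section \<open>The ideal generated by an ideal and one further element\<close>

definition add_elem :: "nat \<Rightarrow> 'a::comm_ring_1 mpoly set \<Rightarrow> 'a mpoly \<Rightarrow> 'a mpoly set" where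
  "add_elem n p a = {f + a * g |f g. f \<in> p \<and> g \<in> carrier (poly_ring n)}"

lemma add_elemE:
  assumes "h \<in> add_elem n p a"
  obtains f g where "h = f + a * g" "f \<in> p" "g \<in> carrier (poly_ring n)"
  using assms by (auto simp: add_elem_def)

lemma ideal_add_elem:
  fixes p :: "'a::comm_ring_1 mpoly set"
  assumes p: "ideal p (poly_ring n)" and a: "a \<in> carrier (poly_ring n)"
  shows "ideal (add_elem n p a) (poly_ring n)"
proof (rule poly_ring_idealI)
  show "add_elem n p a \<subseteq> carrier (poly_ring n)"
    using a p by (auto simp: add_elem_def intro!: carrier_add carrier_mult intro: ideal_carrier)
  show "0 \<in> add_elem n p a"
    unfolding add_elem_def using ideal_0[OF p]
    by (intro CollectI exI[of _ 0]) (simp add: mem_carrier_iff)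
  fix f g assume "f \<in> add_elem n p a" "g \<in> add_elem n p a"
  then obtain f1 f2 g1 g2 where fg: "f = f1 + a * f2" "g = g1 + a * g2"
    "f1 \<in> p" "g1 \<in> p" "f2 \<in> carrier (poly_ring n)" "g2 \<in> carrier (poly_ring n)"
    by (auto elim!: add_elemE)
  have "f + g = (f1 + g1) + a * (f2 + g2)" by (simp add: fg algebra_simps)
  moreover have "f1 + g1 \<in> p" "f2 + g2 \<in> carrier (poly_ring n)"
    using fg by (auto intro: ideal_add[OF p] carrier_add)
  ultimately show "f + g \<in> add_elem n p a" unfolding add_elem_def by blast
next
  fix f g :: "'a mpoly" assume "f \<in> add_elem n p a" and g: "g \<in> carrier (poly_ring n)"
  then obtain f1 f2 where f: "f = f1 + a * f2" "f1 \<in> p" "f2 \<in> carrier (poly_ring n)"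
    by (auto elim!: add_elemE)
  have "g * f = g * f1 + a * (g * f2)" by (simp add: f(1) algebra_simps)
  moreover have "g * f1 \<in> p" "g * f2 \<in> carrier (poly_ring n)"
    using f g by (auto intro: ideal_mult[OF p] carrier_mult)
  ultimately show "g * f \<in> add_elem n p a" unfolding add_elem_def by blast
qed

lemma subset_add_elem: "p \<subseteq> add_elem n p a"
proof
  show "f \<in> add_elem n p a" if "f \<in> p" for f
    unfolding add_elem_def using that
    by (intro CollectI exI[of _ f] exI[of _ 0]) (simp add: mem_carrier_iff)
qed

lemma elem_in_add_elem:
  assumes "ideal p (poly_ring n)"
  shows "(a :: 'a::comm_ring_1 mpoly) \<in> add_elem n p a"
  unfolding add_elem_def using ideal_0[OF assms]
  by (intro CollectI exI[of _ 0] exI[of _ 1]) (simp add: mem_carrier_iff)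

lemma graded_add_elem:
  fixes p :: "'a::comm_ring_1 mpoly set"
  assumes p: "ideal p (poly_ring n)" and gr: "graded p"
    and a: "a \<in> carrier (poly_ring n)" "homogeneous_of e a"
  shows "graded (add_elem n p a)"
  unfolding graded_def
proof (intro ballI allI)
  fix f d assume "f \<in> add_elem n p a"
  then obtain f1 f2 where f: "f = f1 + a * f2" "f1 \<in> p" "f2 \<in> carrier (poly_ring n)"
    by (auto elim!: add_elemE)
  note q = ideal_add_elem[OF p a(1)]
  have "hcomp i a \<in> add_elem n p a" for i
    using elem_in_add_elem[OF p] ideal_0[OF q] by (simp add: hcomp_homogeneous[OF a(2)])
  then have "hcomp d (f2 * a) \<in> add_elem n p a"
    using a(1) f(3) by (subst hcomp_mult[of _ n]) (auto intro!: ideal_sum[OF q] ideal_mult[OF q] restr_carrier)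
  moreover have "hcomp d f1 \<in> add_elem n p a"
    using f(2) gr subset_add_elem[of p n a] by (auto simp: graded_def)
  ultimately show "hcomp d f \<in> add_elem n p a"
    by (simp add: f(1) restr_add ideal_add[OF q] mult.commute)
qed

text \<open>Multiplication by the variable \<xi> on the quotient by \<open>p\<close> has the
  quotient by the larger ideal as cokernel. Concretely, up to degree \<open>Suc d\<close> the larger
  ideal is generated by that part of \<open>p\<close> and by \<xi> times the standard terms of
  degree at most \<open>d\<close>.\<close>

lemma std_count_add_elem:
  fixes p :: "'k::field mpoly set"
  assumes p: "ideal p (poly_ring n)" and gr: "graded p" and \<xi>: "\<xi> \<in> exps n" "tdeg \<xi> = 1"
  shows "std_count n p (Suc d) \<le> std_count n (add_elem n p (monomial 1 \<xi>)) (Suc d) + std_count n p d"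
proof -
  let ?q = "add_elem n p (monomial 1 \<xi>)"
  note q = ideal_add_elem[OF p monomial_carrier[OF \<xi>(1)], of 1]
  define S where "S = terms n d - lead_expos p"
  define X where "X = (\<lambda>\<alpha>. monomial (1 :: 'k) (\<xi> + \<alpha>)) ` S"
  have span: "trunc_ideal n ?q (Suc d) \<subseteq> mp.span (trunc_ideal n p (Suc d) \<union> X)"
  proof
    fix w assume w: "w \<in> trunc_ideal n ?q (Suc d)"
    then obtain f g where fg: "w = f + monomial 1 \<xi> * g" "f \<in> p" "g \<in> carrier (poly_ring n)"
      by (auto simp: trunc_ideal_def elim!: add_elemE)
    \<comment> \<open>Cutting \<open>f\<close> and \<open>g\<close> at these degrees leaves
      \<open>w\<close> unchanged, and gradedness keeps \<open>f'\<close> in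
      \<open>p\<close>.\<close>
    define f' where "f' = restr (\<lambda>\<alpha>. tdeg \<alpha> \<le> Suc d) f"
    define g' where "g' = restr (\<lambda>\<alpha>. tdeg \<alpha> \<le> d) g"
    have "w = restr (\<lambda>\<alpha>. tdeg \<alpha> \<le> Suc d) w"
      using w by (intro restr_eq_self[symmetric]) (auto simp: trunc_ideal_def terms_def)
    also have "\<dots> = f' + monomial 1 \<xi> * g'"
      unfolding fg(1) restr_add f'_def g'_def using restr_monomial_mult[of \<xi> d g] \<xi>(2) by simp
    finally have w_eq: "w = f' + monomial 1 \<xi> * g'" .
    have f': "f' \<in> trunc_ideal n p (Suc d)"
      using graded_restr_tdeg_le[OF gr p fg(2)] ideal_supp[OF p fg(2)]
      by (auto simp: f'_def trunc_ideal_def supp_restr terms_def)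
    have "supp g' \<subseteq> terms n d"
      using fg(3) by (auto simp: g'_def supp_restr terms_def mem_carrier_iff)
    \<comment> \<open>Reducing the cofactor modulo \<open>p\<close> leaves only standard terms; the
      part subtracted contributes an element of \<open>p\<close>.\<close>
    then obtain v where v: "v \<in> trunc_ideal n p d" "supp (g' - v) \<subseteq> S"
      using ex_normal_form[OF finite_terms subspace_trunc_ideal[OF p, of d], of n d g']
      unfolding lead_expos_trunc_ideal[OF p] by (auto simp: trunc_ideal_def S_def)
    have xv: "monomial 1 \<xi> * v \<in> trunc_ideal n p (Suc d)"
      using v(1) \<xi> by (auto simp: trunc_ideal_def supp_monomial_mult terms_def tdeg_add
          intro: ideal_mult[OF p])
    define r where "r = g' - v"
    have "monomial 1 \<xi> * r = (\<Sum>\<alpha>\<in>supp r. monomial (lookup r \<alpha>) 0 * monomial 1 (\<xi> + \<alpha>))"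
      by (subst poly_eq_sum_monomials[of r]) (simp add: sum_distrib_left mult_single)
    also have "\<dots> \<in> mp.span X"
      using v(2) by (intro mp.span_sum mp.span_scale mp.span_base) (auto simp: r_def X_def)
    finally have "monomial 1 \<xi> * r \<in> mp.span (trunc_ideal n p (Suc d) \<union> X)"
      using mp.span_mono[of X "trunc_ideal n p (Suc d) \<union> X"] by blast
    moreover have "w = f' + (monomial 1 \<xi> * v + monomial 1 \<xi> * r)"
      by (simp add: w_eq r_def algebra_simps)
    ultimately show "w \<in> mp.span (trunc_ideal n p (Suc d) \<union> X)"
      using f' xv by (auto intro!: mp.span_add intro: mp.span_base)
  qed
  have "finite X" by (simp add: X_def S_def)
  then have "card (lead_expos (trunc_ideal n ?q (Suc d)))
      \<le> card (lead_expos (trunc_ideal n p (Suc d))) + card X"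
    using span p q subspace_trunc_ideal
    by (intro card_lead_expos_le[OF finite_terms[of n "Suc d"]]) (auto simp: trunc_ideal_def)
  moreover have "card X \<le> std_count n p d"
    unfolding X_def std_count_def S_def by (intro card_image_le) simp
  ultimately show ?thesis
    using card_lead_expos_trunc_ideal[OF p, of "Suc d"] card_lead_expos_trunc_ideal[OF q, of "Suc d"]
    by linarith
qed

section \<open>Growth of the number of standard terms\<close>

definition var_terms :: "nat set \<Rightarrow> nat \<Rightarrow> expo set" where
  "var_terms Y d = {\<alpha>. vars \<alpha> \<subseteq> Y \<and> tdeg \<alpha> \<le> d}"

lemma terms_eq_var_terms: "terms n d = var_terms {1..n} d"
  by (auto simp: terms_def exps_def var_terms_def)

text \<open>Splitting off the exponent of \<open>y\<close> yields the recursion for counting terms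
  in given variables.\<close>

lemma var_terms_insert:
  assumes "y \<notin> Y"
  shows "bij_betw (\<lambda>(j, \<beta>). Poly_Mapping.single y j + \<beta>)
    (SIGMA j:{..d}. var_terms Y (d - j)) (var_terms (insert y Y) d)"
proof (rule bij_betwI[where g = "\<lambda>\<alpha>. (lookup \<alpha> y, \<alpha> - Poly_Mapping.single y (lookup \<alpha> y))"])
  show "(\<lambda>(j, \<beta>). Poly_Mapping.single y j + \<beta>)
      \<in> (SIGMA j:{..d}. var_terms Y (d - j)) \<rightarrow> var_terms (insert y Y) d"
    by (auto simp: var_terms_def vars_add tdeg_add split: if_splits)
  have *: "\<alpha> = Poly_Mapping.single y (lookup \<alpha> y) + (\<alpha> - Poly_Mapping.single y (lookup \<alpha> y))"
    for \<alpha> :: expo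
    by (rule poly_mapping_eqI) (auto simp: lookup_add lookup_minus lookup_single when_def)
  have deg: "tdeg \<alpha> = lookup \<alpha> y + tdeg (\<alpha> - Poly_Mapping.single y (lookup \<alpha> y))" for \<alpha>
    using arg_cong[OF *, of tdeg \<alpha>] by (simp add: tdeg_add)
  have vars: "vars (\<alpha> - Poly_Mapping.single y (lookup \<alpha> y)) = vars \<alpha> - {y}" for \<alpha> :: expo
    by (auto simp: in_keys_iff lookup_minus lookup_single when_def split: if_splits)
  show "(\<lambda>\<alpha>. (lookup \<alpha> y, \<alpha> - Poly_Mapping.single y (lookup \<alpha> y)))
      \<in> var_terms (insert y Y) d \<rightarrow> (SIGMA j:{..d}. var_terms Y (d - j))"
  proof
    fix \<alpha> assume "\<alpha> \<in> var_terms (insert y Y) d"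
    then have "vars \<alpha> \<subseteq> insert y Y" "tdeg \<alpha> \<le> d" by (auto simp: var_terms_def)
    then show "(lookup \<alpha> y, \<alpha> - Poly_Mapping.single y (lookup \<alpha> y))
        \<in> (SIGMA j:{..d}. var_terms Y (d - j))"
      using deg[of \<alpha>] vars[of \<alpha>] by (auto simp: var_terms_def)
  qed
  show "(lookup (case x of (j, \<beta>) \<Rightarrow> Poly_Mapping.single y j + \<beta>) y,
       (case x of (j, \<beta>) \<Rightarrow> Poly_Mapping.single y j + \<beta>)
       - Poly_Mapping.single y (lookup (case x of (j, \<beta>) \<Rightarrow> Poly_Mapping.single y j + \<beta>) y)) = x"
    if x_in: "x \<in> (SIGMA j:{..d}. var_terms Y (d - j))" for x
  proof -
    obtain j \<beta> where x: "x = (j, \<beta>)" "\<beta> \<in> var_terms Y (d - j)" using x_in by auto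
    then have "lookup \<beta> y = 0" using assms by (auto simp: var_terms_def in_keys_iff)
    then show ?thesis by (simp add: x lookup_add)
  qed
  show "(case (lookup \<alpha> y, \<alpha> - Poly_Mapping.single y (lookup \<alpha> y)) of
      (j, \<beta>) \<Rightarrow> Poly_Mapping.single y j + \<beta>) = \<alpha>" for \<alpha> :: expo
    using *[of \<alpha>] by simp
qed

lemma var_terms_card:
  assumes "finite Y"
  shows finite_var_terms: "finite (var_terms Y d)"
    and card_var_terms: "card (var_terms Y d) = (d + card Y) choose (card Y)"
proof -
  have "finite (var_terms Y d) \<and> card (var_terms Y d) = (d + card Y) choose (card Y)"
    using assms
  proof (induction Y arbitrary: d)
    case empty
    have "var_terms {} d = {0}" by (auto simp: var_terms_def)
    then show ?case by simp
  next
    case (insert y Y)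
    have "card (var_terms (insert y Y) d) = card (SIGMA j:{..d}. var_terms Y (d - j))"
      using bij_betw_same_card[OF var_terms_insert[OF insert.hyps(2), of d]] by simp
    also have "\<dots> = (\<Sum>j\<le>d. (d - j + card Y) choose card Y)"
      using insert.IH by (subst card_SigmaI) auto
    also have "\<dots> = (\<Sum>j\<le>d. (card Y + j) choose card Y)"
      by (rule sum.reindex_bij_witness[of _ "\<lambda>j. d - j" "\<lambda>j. d - j"]) (auto simp: add.commute)
    also have "\<dots> = (card Y + d + 1) choose (card Y + 1)" by (rule choose_rising_sum)
    finally have "card (var_terms (insert y Y) d) = (d + card (insert y Y)) choose card (insert y Y)"
      using insert.hyps by (simp add: add.commute)
    moreover have "finite (var_terms (insert y Y) d)"
      using insert.IH bij_betw_finite[OF var_terms_insert[OF insert.hyps(2), of d]] by auto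
    ultimately show ?case by simp
  qed
  then show "finite (var_terms Y d)" "card (var_terms Y d) = (d + card Y) choose (card Y)" by auto
qed

text \<open>In other words, the variables in \<open>Y\<close> are algebraically independent modulo
  \<open>J\<close>.\<close>

definition free_vars :: "'a::comm_ring_1 mpoly set \<Rightarrow> nat set \<Rightarrow> bool" where
  "free_vars J Y \<longleftrightarrow> J \<inter> polys_over Y \<subseteq> {0}"

text \<open>The terms in the variables \<open>Y\<close> are linearly independent modulo
  \<open>J\<close>, since a combination of them is a polynomial in \<open>k[Y]\<close>.\<close>

lemma std_count_ge_free_vars:
  fixes J :: "'k::field mpoly set"
  assumes J: "ideal J (poly_ring n)" and Y: "Y \<subseteq> {1..n}" "free_vars J Y"
  shows "(d + card Y) choose (card Y) \<le> std_count n J d"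
proof -
  have "finite Y" using Y(1) finite_subset by auto
  note fin = finite_var_terms[OF this, of d] and card = card_var_terms[OF this, of d]
  define U :: "'k mpoly set" where "U = {f. supp f \<subseteq> terms n d}"
  have "card (var_terms Y d) + card (lead_expos (trunc_ideal n J d)) \<le> card (lead_expos U)"
  proof (rule card_lead_expos_add_le[where a = "\<lambda>x. monomial 1 x" and M = "terms n d"])
    fix c assume *: "(\<Sum>x\<in>var_terms Y d. monomial (c x) 0 * monomial (1 :: 'k) x) \<in> trunc_ideal n J d"
    define g where "g = (\<Sum>x\<in>var_terms Y d. monomial (c x) x)"
    have lg: "lookup g \<alpha> = (if \<alpha> \<in> var_terms Y d then c \<alpha> else 0)" for \<alpha>
      unfolding g_def by (rule lookup_sum_monomials[OF fin])
    then have "supp g \<subseteq> var_terms Y d" by (auto simp: in_keys_iff split: if_splits)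
    then have "g \<in> polys_over Y" by (auto simp: polys_over_def var_terms_def)
    moreover have "g \<in> J" using * by (simp add: g_def mult_single trunc_ideal_def)
    ultimately have "g = 0" using Y(2) by (auto simp: free_vars_def)
    then show "\<forall>x\<in>var_terms Y d. c x = 0" using lg by (metis lookup_zero)
  next
    have sub: "var_terms Y d \<subseteq> terms n d"
      using Y(1) unfolding terms_eq_var_terms by (auto simp: var_terms_def simp del: One_nat_def)
    show "monomial 1 x \<in> U" if "x \<in> var_terms Y d" for x
      using that sub by (auto simp: U_def)
  qed (use fin J subspace_trunc_ideal subspace_supp in \<open>auto simp: U_def trunc_ideal_def\<close>)
  also have "lead_expos U \<subseteq> terms n d"
    by (rule lead_expos_subset) (simp add: U_def)
  then have "card (lead_expos U) \<le> card (terms n d)" by (intro card_mono) auto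
  finally show ?thesis
    using card_lead_expos_trunc_ideal[OF J, of d] card by linarith
qed

text \<open>A box count: exponents at positions in \<open>Z\<close> are at most \<open>d\<close>,
  those at the other positions are below \<open>N\<close>.\<close>

lemma card_few_large_exponents:
  "card {\<alpha> \<in> terms n d. {i\<in>{1..n}. N \<le> lookup \<alpha> i} \<subseteq> Z} \<le> (d + 1) ^ card (Z \<inter> {1..n}) * N ^ card ({1..n} - Z)"
    (is "card ?S \<le> _")
proof -
  define T where "T = (PiE {1..n} (\<lambda>i. if i \<in> Z then {..d} else {..<N}))"
  have "card ?S \<le> card T"
  proof (rule card_inj_on_le[where f = "\<lambda>\<alpha>. restrict (lookup \<alpha>) {1..n}"])
    show "inj_on (\<lambda>\<alpha>. restrict (lookup \<alpha>) {1..n}) ?S"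
      by (rule inj_on_subset[OF inj_on_restrict_lookup]) (auto simp: terms_def)
    show "(\<lambda>\<alpha>. restrict (lookup \<alpha>) {1..n}) ` ?S \<subseteq> T"
    proof (rule image_subsetI)
      fix \<alpha> assume \<alpha>: "\<alpha> \<in> ?S"
      have "lookup \<alpha> i \<in> (if i \<in> Z then {..d} else {..<N})" if "i \<in> {1..n}" for i
        using \<alpha> that order_trans[OF lookup_le_tdeg[of \<alpha> i], of d]
        by (auto simp: terms_def simp del: One_nat_def intro: leI)
      then show "restrict (lookup \<alpha>) {1..n} \<in> T" by (simp add: T_def)
    qed
    show "finite T" unfolding T_def by (intro finite_PiE) auto
  qed
  also have "card T = (\<Prod>i\<in>{1..n}. if i \<in> Z then d + 1 else N)"
    unfolding T_def by (subst card_PiE) (auto intro!: prod.cong)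
  also have "\<dots> = (\<Prod>i\<in>{1..n} \<inter> Z. d + 1) * (\<Prod>i\<in>{1..n} - Z. N)"
    by (subst prod.If_cases) (auto simp: Diff_eq)
  also have "\<dots> = (d + 1) ^ card (Z \<inter> {1..n}) * N ^ card ({1..n} - Z)"
    by (simp add: Int_commute)
  finally show ?thesis .
qed

text \<open>If each \<open>r\<close> variables support a leading term of \<open>J\<close>, then a standard term has fewer than \<open>r\<close>
  large exponents.\<close>

lemma std_count_le_not_free_vars:
  fixes J :: "'k::field mpoly set"
  assumes J: "ideal J (poly_ring n)"
    and nf: "\<And>Y. Y \<subseteq> {1..n} \<Longrightarrow> card Y = r \<Longrightarrow> \<not> free_vars J Y"
  shows "\<exists>C. \<forall>d. (d + 1) * std_count n J d \<le> C * (d + 1) ^ r"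
proof -
  define \<Y> where "\<Y> = {Y. Y \<subseteq> {1..n} \<and> card Y = r}"
  have fin: "finite \<Y>" by (rule finite_subset[of _ "Pow {1..n}"]) (auto simp: \<Y>_def)
  have "\<exists>\<alpha>. \<alpha> \<in> lead_expos J \<and> vars \<alpha> \<subseteq> Y" if "Y \<in> \<Y>" for Y
  proof -
    have "\<not> free_vars J Y" using nf that by (simp add: \<Y>_def del: One_nat_def)
    then obtain f where f: "f \<in> J" "f \<in> polys_over Y" "f \<noteq> 0" by (auto simp: free_vars_def)
    then show ?thesis using lead_exposI[OF f(1,3)] lead_expo_in[OF f(3)]
      by (auto simp: polys_over_def)
  qed
  then obtain l where l: "\<And>Y. Y \<in> \<Y> \<Longrightarrow> l Y \<in> lead_expos J \<and> vars (l Y) \<subseteq> Y" by metis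
  \<comment> \<open>\<open>N\<close> bounds all exponents of the chosen \<open>l Y\<close>, so
    exponents of at least \<open>N\<close> throughout \<open>Y\<close> force divisibility by the
    term of \<open>l Y\<close>. The successor keeps \<open>N\<close> positive for the power
    estimate.\<close>
  define N where "N = Suc (\<Sum>Y\<in>\<Y>. tdeg (l Y))"
  define L where "L \<alpha> = {i\<in>{1..n}. N \<le> lookup \<alpha> i}" for \<alpha> :: expo
  have Lr: "card (L \<alpha>) < r" if \<alpha>: "\<alpha> \<in> exps n" "\<alpha> \<notin> lead_expos J" for \<alpha>
  proof (rule ccontr)
    assume "\<not> card (L \<alpha>) < r"
    then obtain Y where Y: "Y \<subseteq> L \<alpha>" "card Y = r" by (metis not_less obtain_subset_with_card_n)
    then have Y\<Y>: "Y \<in> \<Y>" by (auto simp: \<Y>_def L_def)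
    have le: "lookup (l Y) i \<le> lookup \<alpha> i" for i
    proof (cases "i \<in> vars (l Y)")
      case True
      then have "N \<le> lookup \<alpha> i" using l[OF Y\<Y>] Y(1) by (auto simp: L_def)
      moreover have "lookup (l Y) i \<le> N"
        using lookup_le_tdeg[of "l Y" i] member_le_sum[of Y \<Y> "\<lambda>Y. tdeg (l Y)"] fin Y\<Y>
        by (simp add: N_def)
      ultimately show ?thesis by simp
    qed (simp add: in_keys_iff)
    have eq: "\<alpha> = (\<alpha> - l Y) + l Y"
      by (rule poly_mapping_eqI) (simp add: lookup_add lookup_minus le)
    then have "\<alpha> - l Y \<in> exps n" using \<alpha>(1) exps_add_iff[of "\<alpha> - l Y" "l Y" n] by metis
    then have "\<alpha> \<in> lead_expos J" using lead_expos_ideal_add[OF J] l[OF Y\<Y>] eq by metis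
    then show False using \<alpha>(2) by simp
  qed
  \<comment> \<open>The candidates for the set of positions of large exponents.\<close>
  define \<Z> where "\<Z> = {Z. Z \<subseteq> {1..n} \<and> card Z < r}"
  have fin\<Z>: "finite \<Z>" by (rule finite_subset[of _ "Pow {1..n}"]) (auto simp: \<Z>_def)
  \<comment> \<open>The factor \<open>d + 1\<close> on the left replaces an exponent
    \<open>r - 1\<close> on the right, which would be truncated for \<open>r = 0\<close>.\<close>
  have "(d + 1) * std_count n J d \<le> (card \<Z> * N ^ n) * (d + 1) ^ r" for d
  proof -
    have "terms n d - lead_expos J \<subseteq> (\<Union>Z\<in>\<Z>. {\<alpha> \<in> terms n d. L \<alpha> \<subseteq> Z})"
    proof
      fix \<alpha> assume "\<alpha> \<in> terms n d - lead_expos J"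
      then have "L \<alpha> \<in> \<Z>" "\<alpha> \<in> terms n d" using Lr[of \<alpha>] by (auto simp: \<Z>_def terms_def L_def)
      then show "\<alpha> \<in> (\<Union>Z\<in>\<Z>. {\<alpha> \<in> terms n d. L \<alpha> \<subseteq> Z})" by blast
    qed
    then have "std_count n J d \<le> card (\<Union>Z\<in>\<Z>. {\<alpha> \<in> terms n d. L \<alpha> \<subseteq> Z})"
      unfolding std_count_def using fin\<Z> by (intro card_mono) auto
    also have "\<dots> \<le> (\<Sum>Z\<in>\<Z>. card {\<alpha> \<in> terms n d. L \<alpha> \<subseteq> Z})"
      by (rule card_UN_le[OF fin\<Z>])
    finally have "(d + 1) * std_count n J d \<le> (\<Sum>Z\<in>\<Z>. (d + 1) * card {\<alpha> \<in> terms n d. L \<alpha> \<subseteq> Z})"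
      unfolding sum_distrib_left[symmetric] by (rule mult_left_mono) simp
    also have "\<dots> \<le> (\<Sum>Z\<in>\<Z>. N ^ n * (d + 1) ^ r)"
    proof (rule sum_mono)
      fix Z assume Z: "Z \<in> \<Z>"
      then have "Z \<inter> {1..n} = Z" by (auto simp: \<Z>_def)
      then have "card {\<alpha> \<in> terms n d. L \<alpha> \<subseteq> Z} \<le> (d + 1) ^ card Z * N ^ card ({1..n} - Z)"
        unfolding L_def using card_few_large_exponents[of n d N Z] by simp
      also have "N ^ card ({1..n} - Z) \<le> N ^ n"
      proof (rule power_increasing)
        show "card ({1..n} - Z) \<le> n" using card_mono[of "{1..n}" "{1..n} - Z"] by auto
      qed (simp add: N_def)
      finally have "(d + 1) * card {\<alpha> \<in> terms n d. L \<alpha> \<subseteq> Z} \<le> (d + 1) * ((d + 1) ^ card Z * N ^ n)"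
        by (intro mult_left_mono) simp_all
      also have "\<dots> = N ^ n * (d + 1) ^ Suc (card Z)" by (simp add: algebra_simps)
      also have "\<dots> \<le> N ^ n * (d + 1) ^ r"
        using Z by (intro mult_left_mono power_increasing) (auto simp: \<Z>_def)
      finally show "(d + 1) * card {\<alpha> \<in> terms n d. L \<alpha> \<subseteq> Z} \<le> N ^ n * (d + 1) ^ r" .
    qed
    finally show ?thesis by (simp add: mult.assoc)
  qed
  then show ?thesis by blast
qed

section \<open>Chains of prime ideals\<close>

text \<open>Iterates \<open>std_count_prime_less\<close>; by monotonicity each of the
  \<open>t\<close> steps adds at least \<open>std_count n q d\<close>.\<close>

lemma std_count_prime_power:
  fixes p q :: "'k::field mpoly set"
  assumes p: "primeideal p (poly_ring n)" and q: "ideal q (poly_ring n)" and "p \<subseteq> q"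
    and f: "f \<in> q" "f \<notin> p" "supp f \<subseteq> terms n e"
  shows "t * std_count n q d \<le> std_count n p (d + t * e)"
proof (induction t)
  case (Suc t)
  have "std_count n q (d + Suc t * e) + std_count n p (d + Suc t * e - e) \<le> std_count n p (d + Suc t * e)"
    by (rule std_count_prime_less[OF p q \<open>p \<subseteq> q\<close> f]) simp
  moreover have "std_count n q d \<le> std_count n q (d + Suc t * e)" by (rule std_count_mono) simp
  ultimately show ?case using Suc by (simp add: add.commute)
qed simp

text \<open>By degree compatibility, a nonzero polynomial with leading exponent 0 is a nonzero
  constant, hence a unit.\<close>

lemma zero_notin_lead_expos:
  fixes p :: "'k::field mpoly set"
  assumes "ideal p (poly_ring n)" "p \<noteq> carrier (poly_ring n)"
  shows "0 \<notin> lead_expos p"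
proof
  assume "0 \<in> lead_expos p"
  then obtain f where f: "f \<in> p" "f \<noteq> 0" "lead_expo f = 0" by (rule lead_exposE)
  have supp: "supp f \<subseteq> {0}" using tdeg_le_lead_expo[of _ f] f(3) by auto
  then have f_eq: "f = monomial (lookup f 0) 0"
    by (intro poly_mapping_eqI) (auto simp: lookup_single when_def in_keys_iff)
  then have nz: "lookup f 0 \<noteq> 0" using f(2) by auto
  have "g \<in> p" if g: "g \<in> carrier (poly_ring n)" for g
  proof -
    have "(g * monomial (inverse (lookup f 0)) 0) * f \<in> p"
      using g by (intro ideal_mult[OF assms(1) f(1)] carrier_mult) auto
    moreover have "(g * monomial (inverse (lookup f 0)) 0) * f = g"
      by (subst f_eq) (simp add: mult_single mult.assoc nz)
    ultimately show ?thesis by simp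
  qed
  then show False using assms ideal_carrier by blast
qed

lemma std_count_ge_1:
  fixes p :: "'k::field mpoly set"
  assumes "ideal p (poly_ring n)" "p \<noteq> carrier (poly_ring n)"
  shows "1 \<le> std_count n p d"
proof -
  have "{0} \<subseteq> terms n d - lead_expos p" using zero_notin_lead_expos[OF assms] by (simp add: terms_def)
  then have "card {0 :: expo} \<le> std_count n p d" unfolding std_count_def by (intro card_mono) auto
  then show ?thesis by simp
qed

text \<open>Each strict inclusion of primes contributes a factor \<open>j\<close>, at the price of
  enlarging \<open>e\<close> by the degree of an element separating the two primes. Evaluating at
  multiples of \<open>j\<close> avoids division.\<close>

lemma std_count_ge_chain:
  fixes p :: "nat \<Rightarrow> 'k::field mpoly set"
  assumes "\<And>i. i \<le> m \<Longrightarrow> primeideal (p i) (poly_ring n)" "\<And>i. i < m \<Longrightarrow> p i \<subset> p (Suc i)"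
  shows "\<exists>e. \<forall>j. j ^ m \<le> std_count n (p 0) (e * j)"
  using assms
proof (induction m arbitrary: p)
  case 0
  interpret primeideal "p 0" "poly_ring n" using "0.prems" by simp
  show ?case using std_count_ge_1[OF is_ideal] I_notcarr by auto
next
  case (Suc m)
  have pr: "primeideal (p 0) (poly_ring n)" "primeideal (p 1) (poly_ring n)" "p 0 \<subset> p 1"
    using Suc.prems by auto
  then obtain f where f: "f \<in> p 1" "f \<notin> p 0" by auto
  have p1: "ideal (p 1) (poly_ring n)" using pr(2) by (simp add: primeideal_def)
  obtain e where e: "\<forall>j. j ^ m \<le> std_count n (p 1) (e * j)"
    using Suc.IH[of "\<lambda>i. p (Suc i)"] Suc.prems by auto
  define e' where "e' = tdeg (lead_expo f)"
  have "j ^ Suc m \<le> std_count n (p 0) ((e + e') * j)" for j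
  proof -
    have "j ^ Suc m \<le> j * std_count n (p 1) (e * j)" using e by simp
    also have "\<dots> \<le> std_count n (p 0) (e * j + j * e')"
      unfolding e'_def
      by (rule std_count_prime_power[OF pr(1) p1 _ f]) (use pr(3) supp_subset_terms[OF ideal_carrier[OF p1 f(1)]] in auto)
    finally show ?thesis by (simp add: algebra_simps)
  qed
  then show ?case by blast
qed

lemma polys_over_mult:
  "f \<in> polys_over Y \<Longrightarrow> g \<in> polys_over Y \<Longrightarrow> f * g \<in> polys_over Y"
  using keys_mult[of f g] by (fastforce simp: polys_over_def vars_add)

text \<open>If neither factor lies in \<open>K\<close>, take the highest component of each outside
  \<open>K\<close>, of degrees \<open>i\<close> and \<open>j\<close>. In the component of degree
  \<open>i + j\<close> of the product, every other summand has a factor above one of these two,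
  hence in \<open>K\<close>.\<close>

lemma graded_primeI:
  fixes K :: "'k::field mpoly set"
  assumes K: "ideal K (poly_ring n)" and gr: "graded K" and ne: "K \<noteq> carrier (poly_ring n)"
    and hom: "\<And>a b d e. a \<in> carrier (poly_ring n) \<Longrightarrow> b \<in> carrier (poly_ring n) \<Longrightarrow>
      homogeneous_of d a \<Longrightarrow> homogeneous_of e b \<Longrightarrow> a * b \<in> K \<Longrightarrow> a \<in> K \<or> b \<in> K"
  shows "primeideal K (poly_ring n)"
proof (rule primeidealI[OF K cring_poly_ring])
  fix a b :: "'k mpoly"
  assume ab: "a \<in> carrier (poly_ring n)" "b \<in> carrier (poly_ring n)" "a \<otimes>\<^bsub>poly_ring n\<^esub> b \<in> K"
  have top: "\<exists>i. hcomp i f \<notin> K \<and> (\<forall>j>i. hcomp j f \<in> K)"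
    if f: "f \<in> carrier (poly_ring n)" "f \<notin> K" for f
  proof -
    define A where "A = {i. hcomp i f \<notin> K}"
    have "A \<subseteq> tdeg ` supp f"
    proof
      fix i assume "i \<in> A"
      then have "hcomp i f \<noteq> 0" using ideal_0[OF K] by (auto simp: A_def)
      then show "i \<in> tdeg ` supp f" using restr_eq_0[of f "\<lambda>\<alpha>. tdeg \<alpha> = i"] by auto
    qed
    then have fin: "finite A" by (rule finite_subset) simp
    have "A \<noteq> {}"
    proof
      assume "A = {}"
      then have "(\<Sum>i\<le>tdeg (lead_expo f). hcomp i f) \<in> K" by (intro ideal_sum[OF K]) (auto simp: A_def)
      then show False using f eq_sum_hcomp[OF supp_subset_terms[OF f(1)]] by simp
    qed
    then have "Max A \<in> A" by (rule Max_in[OF fin])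
    moreover have "\<forall>j>Max A. j \<notin> A" using Max_ge[OF fin] by (meson leD)
    moreover have "\<And>i. i \<in> A \<longleftrightarrow> hcomp i f \<notin> K" by (simp add: A_def)
    ultimately show ?thesis by blast
  qed
  show "a \<in> K \<or> b \<in> K"
  proof (rule ccontr)
    assume "\<not> (a \<in> K \<or> b \<in> K)"
    then obtain i j where i: "hcomp i a \<notin> K" "\<forall>k>i. hcomp k a \<in> K"
      and j: "hcomp j b \<notin> K" "\<forall>k>j. hcomp k b \<in> K"
      using top[OF ab(1)] top[OF ab(2)] by blast
    have "hcomp (i + j) (a * b) \<in> K" using gr ab(3) by (simp add: graded_def)
    moreover have "hcomp (i + j) (a * b) = hcomp i a * hcomp j b
        + (\<Sum>k\<in>{..i + j} - {i}. hcomp k a * hcomp (i + j - k) b)"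
      unfolding hcomp_mult[OF ab(1,2)] by (subst sum.remove[of _ i]) auto
    moreover have "(\<Sum>k\<in>{..i + j} - {i}. hcomp k a * hcomp (i + j - k) b) \<in> K"
    proof (rule ideal_sum[OF K])
      fix k assume k: "k \<in> {..i + j} - {i}"
      show "hcomp k a * hcomp (i + j - k) b \<in> K"
      proof (cases "k < i")
        case True
        then have "i + j - k > j" by simp
        then show ?thesis using j(2) restr_carrier[OF ab(1)] by (intro ideal_mult[OF K]) auto
      next
        case False
        then have "hcomp k a \<in> K" using k i(2) by auto
        then show ?thesis
          using restr_carrier[OF ab(2)] ideal_mult[OF K] by (subst mult.commute) auto
      qed
    qed
    ultimately have "hcomp i a * hcomp j b \<in> K" using ideal_diff[OF K] by fastforce
    then show False
      using hom[OF restr_carrier[OF ab(1)] restr_carrier[OF ab(2)] homogeneous_hcomp homogeneous_hcomp]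
        i(1) j(1) by blast
  qed
qed (use ne in auto)

text \<open>Zorn's lemma provides \<open>K\<close>, maximal among the graded ideals that contain
  \<open>J\<close> and meet \<open>k[Y]\<close> in 0. For homogeneous \<open>a\<close> and
  \<open>b\<close> outside \<open>K\<close>, adjoining either one to \<open>K\<close> produces a
  nonzero element of \<open>k[Y]\<close>; if \<open>a * b\<close> were in \<open>K\<close>, the
  nonzero product of these elements would be in \<open>K\<close> too.\<close>

lemma ex_graded_prime:
  fixes J :: "'k::field mpoly set"
  assumes J: "ideal J (poly_ring n)" "graded J" and Y: "Y \<subseteq> {1..n}" "free_vars J Y"
  obtains p where "primeideal p (poly_ring n)" "graded p" "J \<subseteq> p" "free_vars p Y"
proof -
  define A where "A = {K. ideal K (poly_ring n) \<and> graded K \<and> J \<subseteq> K \<and> free_vars K Y}"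
  have "\<exists>M\<in>A. \<forall>X\<in>A. M \<subseteq> X \<longrightarrow> X = M"
  proof (rule subset_Zorn_nonempty)
    show "A \<noteq> {}" using assms by (auto simp: A_def)
    fix \<C> assume ne: "\<C> \<noteq> {}" and ch: "subset.chain A \<C>"
    have CA: "K \<in> A" if "K \<in> \<C>" for K using ch that by (auto simp: subset.chain_def)
    then have Ki: "ideal K (poly_ring n)" if "K \<in> \<C>" for K using that by (auto simp: A_def)
    have "ideal (\<Union>\<C>) (poly_ring n)"
    proof (rule poly_ring_idealI)
      show "\<Union>\<C> \<subseteq> carrier (poly_ring n)" using ideal_carrier[OF Ki] by blast
      show "0 \<in> \<Union>\<C>" using ideal_0[OF Ki] ne by blast
    next
      fix f g assume "f \<in> \<Union>\<C>" "g \<in> \<Union>\<C>"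
      then obtain K L where KL: "K \<in> \<C>" "L \<in> \<C>" "f \<in> K" "g \<in> L" by blast
      then have "K \<subseteq> L \<or> L \<subseteq> K" using ch by (auto simp: subset.chain_def)
      then show "f + g \<in> \<Union>\<C>" using KL ideal_add[OF Ki] by blast
    next
      fix f g :: "'k mpoly" assume "f \<in> \<Union>\<C>" "g \<in> carrier (poly_ring n)"
      then show "g * f \<in> \<Union>\<C>" using ideal_mult[OF Ki] by blast
    qed
    moreover have "graded (\<Union>\<C>)"
      unfolding graded_def
    proof (intro ballI allI)
      fix f d assume "f \<in> \<Union>\<C>"
      then obtain K where "K \<in> \<C>" "f \<in> K" by blast
      moreover from this have "graded K" using CA by (simp add: A_def)
      ultimately show "hcomp d f \<in> \<Union>\<C>" by (auto simp: graded_def)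
    qed
    moreover have "J \<subseteq> \<Union>\<C>" using ne CA by (auto simp: A_def)
    moreover have "free_vars (\<Union>\<C>) Y" using CA by (fastforce simp: A_def free_vars_def)
    ultimately show "\<Union>\<C> \<in> A" by (simp add: A_def)
  qed
  then obtain K where "K \<in> A" and max: "\<And>X. X \<in> A \<Longrightarrow> K \<subseteq> X \<Longrightarrow> X = K" by blast
  then have K: "ideal K (poly_ring n)" "graded K" "J \<subseteq> K" "free_vars K Y" by (auto simp: A_def)
  have "primeideal K (poly_ring n)"
  proof (rule graded_primeI[OF K(1,2)])
    have "(1 :: 'k mpoly) \<in> polys_over Y" by (simp add: polys_over_def)
    then have "1 \<notin> K" using K(4) by (auto simp: free_vars_def)
    moreover have "(1 :: 'k mpoly) \<in> carrier (poly_ring n)" by (simp add: mem_carrier_iff)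
    ultimately show "K \<noteq> carrier (poly_ring n)" by blast
    fix a b d e
    assume a: "a \<in> carrier (poly_ring n)" "homogeneous_of d a"
      and b: "b \<in> carrier (poly_ring n)" "homogeneous_of e b" and ab: "a * b \<in> K"
    have meet: "\<exists>s\<in>polys_over Y. s \<noteq> 0 \<and> s \<in> add_elem n K c"
      if c: "c \<in> carrier (poly_ring n)" "homogeneous_of i c" "c \<notin> K" for c i
    proof -
      have "add_elem n K c \<noteq> K" using elem_in_add_elem[OF K(1)] c(3) by blast
      then have "add_elem n K c \<notin> A" using max subset_add_elem by blast
      then have "\<not> free_vars (add_elem n K c) Y"
        using ideal_add_elem[OF K(1) c(1)] graded_add_elem[OF K(1,2) c(1,2)] K(3)
          subset_add_elem[of K n c] by (auto simp: A_def)
      then show ?thesis by (auto simp: free_vars_def)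
    qed
    show "a \<in> K \<or> b \<in> K"
    proof (rule ccontr)
      assume "\<not> (a \<in> K \<or> b \<in> K)"
      then obtain s t where s: "s \<in> polys_over Y" "s \<noteq> 0" "s \<in> add_elem n K a"
        and t: "t \<in> polys_over Y" "t \<noteq> 0" "t \<in> add_elem n K b"
        using meet[OF a] meet[OF b] by blast
      obtain f g where fg: "s = f + a * g" "f \<in> K" "g \<in> carrier (poly_ring n)"
        using s(3) by (rule add_elemE)
      obtain f' g' where fg': "t = f' + b * g'" "f' \<in> K" "g' \<in> carrier (poly_ring n)"
        using t(3) by (rule add_elemE)
      \<comment> \<open>Every summand of the expanded product has a factor in \<open>K\<close>:
        \<open>f\<close>, \<open>f'\<close> or \<open>a * b\<close>.\<close>
      have "s * t = t * f + ((a * g) * f' + (g * g') * (a * b))"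
        by (simp add: fg(1) fg'(1) algebra_simps)
      also have "\<dots> \<in> K"
      proof -
        have "t \<in> carrier (poly_ring n)"
          using t(3) ideal_carrier[OF ideal_add_elem[OF K(1) b(1)]] by blast
        then have "t * f \<in> K" using fg(2) by (intro ideal_mult[OF K(1)])
        moreover have "(a * g) * f' \<in> K" using a fg fg' by (intro ideal_mult[OF K(1)] carrier_mult)
        moreover have "(g * g') * (a * b) \<in> K" using ab fg fg' by (intro ideal_mult[OF K(1) ab] carrier_mult)
        ultimately show ?thesis by (intro ideal_add[OF K(1)])
      qed
      finally have "s * t = 0" using polys_over_mult[OF s(1) t(1)] K(4) by (auto simp: free_vars_def)
      then show False using s(2) t(2) by simp
    qed
  qed
  then show ?thesis using that K by blast
qed

text \<open>A division-free form of the bound \<open>(N / k) ^ k \<le> N choose k\<close>, showing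
  growth of order \<open>k\<close>.\<close>

lemma power_le_binomial: "(d + k) ^ k \<le> k ^ k * ((d + k) choose k)"
proof (cases "k = 0")
  case False
  have "(real (d + k) / real k) ^ k \<le> real ((d + k) choose k)"
    by (rule binomial_ge_n_over_k_pow_k) simp
  then have "real (d + k) ^ k \<le> real k ^ k * real ((d + k) choose k)"
    using False by (simp add: power_divide field_simps)
  then have "real ((d + k) ^ k) \<le> real (k ^ k * ((d + k) choose k))" by simp
  then show ?thesis by (simp only: of_nat_le_iff)
qed simp

text \<open>Otherwise \<open>d + 1\<close> times the count for the larger ideal has order at most
  \<open>r\<close>. Summing over degrees then bounds the count for \<open>p\<close> by the same
  order, against the order \<open>r + 1\<close> enforced by \<open>Y\<close>.\<close>

lemma ex_free_vars_add_elem: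
  fixes p :: "'k::field mpoly set"
  assumes p: "ideal p (poly_ring n)" "graded p" and Y: "Y \<subseteq> {1..n}" "card Y = Suc r" "free_vars p Y"
    and \<xi>: "\<xi> \<in> exps n" "tdeg \<xi> = 1"
  shows "\<exists>Z\<subseteq>{1..n}. card Z = r \<and> free_vars (add_elem n p (monomial 1 \<xi>)) Z"
proof (rule ccontr)
  let ?q = "add_elem n p (monomial 1 \<xi>)"
  assume no: "\<not> (\<exists>Z\<subseteq>{1..n}. card Z = r \<and> free_vars ?q Z)"
  have q: "ideal ?q (poly_ring n)" using ideal_add_elem[OF p(1)] \<xi> by simp
  obtain C where C: "\<And>d. (d + 1) * std_count n ?q d \<le> C * (d + 1) ^ r"
    using std_count_le_not_free_vars[OF q, of r] no by blast
  have sum: "std_count n p d \<le> 1 + d * std_count n ?q d" for d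
  proof (induction d)
    case 0
    have "terms n 0 \<subseteq> {0}" by (auto simp: terms_def)
    then have "std_count n p 0 \<le> card {0 :: expo}" unfolding std_count_def by (intro card_mono) auto
    then show ?case by simp
  next
    case (Suc d)
    have "std_count n p (Suc d) \<le> std_count n ?q (Suc d) + std_count n p d"
      by (rule std_count_add_elem[OF p \<xi>])
    also have "\<dots> \<le> std_count n ?q (Suc d) + (1 + d * std_count n ?q (Suc d))"
      using Suc std_count_mono[of d "Suc d" n ?q] mult_le_mono2[of "std_count n ?q d" "std_count n ?q (Suc d)" d]
      by linarith
    finally show ?case by simp
  qed
  define k where "k = Suc r"
  \<comment> \<open>At this degree the additional factor \<open>d + 1\<close> outweighs the
    constants \<open>k ^ k\<close> and \<open>C + 1\<close> together.\<close>
  define d where "d = k ^ k * (C + 2) - 1"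
  have d1: "d + 1 = k ^ k * (C + 2)" by (simp add: d_def k_def)
  have "(d + 1) ^ k \<le> (d + k) ^ k" by (intro power_mono) (auto simp: k_def)
  also have "\<dots> \<le> k ^ k * ((d + k) choose k)" by (rule power_le_binomial)
  also have "((d + k) choose k) \<le> std_count n p d"
    using std_count_ge_free_vars[OF p(1) Y(1,3), of d] Y(2) by (simp add: k_def)
  also have "std_count n p d \<le> 1 + (d + 1) * std_count n ?q d" using sum[of d] by simp
  also have "\<dots> \<le> 1 + C * (d + 1) ^ r" using C[of d] by simp
  also have "\<dots> \<le> (C + 1) * (d + 1) ^ r" by simp
  also have "k ^ k * ((C + 1) * (d + 1) ^ r) < k ^ k * ((C + 2) * (d + 1) ^ r)"
    by (intro mult_strict_left_mono mult_strict_right_mono) (auto simp: k_def)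
  also have "\<dots> = (d + 1) * (d + 1) ^ r" by (simp only: d1 mult.assoc)
  also have "\<dots> = (d + 1) ^ k" by (simp add: k_def)
  finally show False by simp
qed

text \<open>A variable in \<open>Y\<close> lies outside \<open>p0\<close> because it belongs to
  \<open>k[Y]\<close>. Adjoining it gives a graded ideal strictly above \<open>p0\<close> that still
  has \<open>r\<close> free variables; the chain over it is then prefixed by
  \<open>p0\<close>.\<close>

lemma ex_prime_chain:
  fixes J :: "'k::field mpoly set"
  assumes "ideal J (poly_ring n)" "graded J" "Y \<subseteq> {1..n}" "card Y = r" "free_vars J Y"
  shows "\<exists>p. (\<forall>i\<le>r. primeideal (p i) (poly_ring n)) \<and> (\<forall>i<r. p i \<subset> p (Suc i)) \<and> J \<subseteq> p 0"
  using assms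
proof (induction r arbitrary: J Y)
  case 0
  obtain p where "primeideal p (poly_ring n)" "J \<subseteq> p"
    using ex_graded_prime[OF "0.prems"(1-3,5)] by blast
  then show ?case by (intro exI[of _ "\<lambda>_. p"]) auto
next
  case (Suc r)
  obtain p0 where p0: "primeideal p0 (poly_ring n)" "graded p0" "J \<subseteq> p0" "free_vars p0 Y"
    using ex_graded_prime[OF Suc.prems(1-3,5)] by blast
  then have p0i: "ideal p0 (poly_ring n)" by (simp add: primeideal_def)
  obtain i where i: "i \<in> Y" using Suc.prems(4) by fastforce
  define \<xi> where "\<xi> = Poly_Mapping.single i (1 :: nat)"
  have \<xi>: "\<xi> \<in> exps n" "tdeg \<xi> = 1" using i Suc.prems(3) by (auto simp: \<xi>_def exps_def)
  let ?q = "add_elem n p0 (monomial 1 \<xi>)"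
  have "monomial 1 \<xi> \<in> polys_over Y" using i by (simp add: polys_over_def \<xi>_def)
  then have nin: "monomial 1 \<xi> \<notin> p0" using p0(4) by (auto simp: free_vars_def)
  obtain Z where Z: "Z \<subseteq> {1..n}" "card Z = r" "free_vars ?q Z"
    using ex_free_vars_add_elem[OF p0i p0(2) Suc.prems(3,4) p0(4) \<xi>] by blast
  have "graded ?q" using \<xi> by (intro graded_add_elem[OF p0i p0(2), of _ 1]) (auto simp: homogeneous_of_def)
  moreover have "ideal ?q (poly_ring n)" using \<xi> by (intro ideal_add_elem p0i) auto
  ultimately obtain p where p: "\<forall>i\<le>r. primeideal (p i) (poly_ring n)" "\<forall>i<r. p i \<subset> p (Suc i)" "?q \<subseteq> p 0"
    using Suc.IH[OF _ _ Z] by blast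
  have "p0 \<subset> p 0"
    using p(3) subset_add_elem[of p0 n "monomial 1 \<xi>"] elem_in_add_elem[OF p0i, of "monomial 1 \<xi>"] nin by blast
  then show ?case
    using p p0(1,3) by (intro exI[of _ "case_nat p0 p"]) (auto split: nat.split simp: less_Suc_eq_0_disj)
qed

section \<open>Krull dimension\<close>

context cring
begin

text \<open>One half of the correspondence between primes over \<open>I\<close> and primes of the
  quotient; the membership test transfers strictness of inclusions.\<close>

lemma quot_primeideal_image:
  assumes I: "ideal I R" and P: "primeideal P R" and IP: "I \<subseteq> P"
  shows "primeideal ((+>) I ` P) (R Quot I)"
    and "a \<in> carrier R \<Longrightarrow> I +> a \<in> (+>) I ` P \<longleftrightarrow> a \<in> P"
proof -
  interpret P: primeideal P R by (rule P)
  have img: "ideal ((+>) I ` P) (R Quot I)" by (rule ring_ideal_imp_quot_ideal[OF I P.is_ideal])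
  have "(+>) I ` P \<subseteq> carrier (R Quot I)" using additive_subgroup.a_subset ideal.axioms(1)[OF img] by blast
  from canonical_proj_vimage_mem_iff[OF I this]
  show mem: "I +> a \<in> (+>) I ` P \<longleftrightarrow> a \<in> P" if "a \<in> carrier R" for a
    using that ideal_incl_iff[OF I P.is_ideal] IP by auto
  have carr: "\<exists>r\<in>carrier R. x = I +> r" if "x \<in> carrier (R Quot I)" for x
    using that unfolding FactRing_def using A_RCOSETS_def'[of R I] by auto
  show "primeideal ((+>) I ` P) (R Quot I)"
  proof (rule primeidealI[OF img ideal.quotient_is_cring[OF I is_cring]])
    show "carrier (R Quot I) \<noteq> (+>) I ` P"
    proof
      assume "carrier (R Quot I) = (+>) I ` P"
      then have "I +> \<one> \<in> (+>) I ` P"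
        using ring_hom_closed[OF ideal.rcos_ring_hom[OF I], of \<one>] by simp
      then show False using mem P.one_imp_carrier P.I_notcarr by auto
    qed
    fix x y assume xy: "x \<in> carrier (R Quot I)" "y \<in> carrier (R Quot I)" "x \<otimes>\<^bsub>R Quot I\<^esub> y \<in> (+>) I ` P"
    then obtain a b where ab: "a \<in> carrier R" "x = I +> a" "b \<in> carrier R" "y = I +> b"
      using carr by meson
    then have "I +> (a \<otimes> b) \<in> (+>) I ` P"
      using xy(3) ring_hom_mult[OF ideal.rcos_ring_hom[OF I], of a b] by simp
    then have "a \<otimes> b \<in> P" using mem ab by simp
    then show "x \<in> (+>) I ` P \<or> y \<in> (+>) I ` P" using P.I_prime ab by blast
  qed
qed

lemma krull_dim_quot_geI:
  assumes I: "ideal I R" and p: "\<And>i. i \<le> m \<Longrightarrow> primeideal (p i) R" "\<And>i. i < m \<Longrightarrow> p i \<subset> p (Suc i)"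
    and Ip: "I \<subseteq> p 0"
  shows "enat m \<le> krull_dim (R Quot I)"
proof -
  have Ip': "I \<subseteq> p i" if "i \<le> m" for i
    using that by (induction i) (use Ip p(2) in \<open>auto simp: Suc_le_eq\<close>)
  have "primeideal ((+>) I ` p i) (R Quot I)" if "i \<le> m" for i
    using quot_primeideal_image(1)[OF I p(1) Ip'] that by simp
  moreover have "(+>) I ` p i \<subset> (+>) I ` p (Suc i)" if i: "i < m" for i
  proof -
    obtain a where a: "a \<in> p (Suc i)" "a \<notin> p i" using p(2)[OF i] by blast
    interpret P: primeideal "p (Suc i)" R using p(1)[of "Suc i"] i by simp
    have "a \<in> carrier R" using a(1) P.a_subset by blast
    then have "I +> a \<notin> (+>) I ` p i"
      using quot_primeideal_image(2)[OF I p(1) Ip', of i a] a(2) i by simp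
    then show ?thesis using p(2)[OF i] a(1) by blast
  qed
  ultimately show ?thesis unfolding krull_dim_def
    by (intro Sup_upper CollectI exI[of _ m] conjI refl exI[of _ "\<lambda>i. (+>) I ` p i"]) auto
qed

text \<open>A positive finite supremum is attained, since otherwise all chain lengths would be at
  most \<open>D - 1\<close>; the value 0 could also be the supremum of the empty set. The chain in
  the quotient is pulled back along the projection.\<close>

lemma ex_prime_chain_krull_dim:
  assumes I: "ideal I R" and D: "krull_dim (R Quot I) = enat D" "D > 0"
  shows "\<exists>p. (\<forall>i\<le>D. primeideal (p i) R) \<and> (\<forall>i<D. p i \<subset> p (Suc i)) \<and> I \<subseteq> p 0"
proof -
  define S where "S = {m. \<exists>\<pp> :: nat \<Rightarrow> 'a set set.
     (\<forall>i\<le>m. primeideal (\<pp> i) (R Quot I)) \<and> (\<forall>i<m. \<pp> i \<subset> \<pp> (Suc i))}"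
  have Sup: "Sup (enat ` S) = enat D"
    using D(1) unfolding krull_dim_def S_def by (simp add: image_Collect)
  have "D \<in> S"
  proof (rule ccontr)
    assume nD: "D \<notin> S"
    have "m \<le> D - 1" if "m \<in> S" for m
    proof -
      have "enat m \<le> enat D" unfolding Sup[symmetric] using that by (intro Sup_upper) auto
      then have "m \<le> D" by simp
      moreover have "m \<noteq> D" using that nD by blast
      ultimately show ?thesis by simp
    qed
    then have "Sup (enat ` S) \<le> enat (D - 1)" by (intro Sup_least) auto
    then show False using D(2) Sup by simp
  qed
  then obtain q where q: "\<And>i. i \<le> D \<Longrightarrow> primeideal (q i) (R Quot I)" "\<And>i. i < D \<Longrightarrow> q i \<subset> q (Suc i)"
    by (auto simp: S_def)
  define p where "p i = {r \<in> carrier R. I +> r \<in> q i}" for i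
  have "primeideal (p i) R" if "i \<le> D" for i
    unfolding p_def
    by (rule ring_hom_ring.primeideal_vimage[OF ideal.rcos_ring_hom_ring[OF I] is_cring q(1)[OF that]])
  moreover have "p i \<subset> p (Suc i)" if i: "i < D" for i
  proof -
    obtain x where x: "x \<in> q (Suc i)" "x \<notin> q i" using q(2)[OF i] by blast
    interpret Q: primeideal "q (Suc i)" "R Quot I" using q(1)[of "Suc i"] i by simp
    have "x \<in> carrier (R Quot I)" using x(1) Q.a_subset by blast
    then obtain r where "r \<in> carrier R" "x = I +> r"
      unfolding FactRing_def using A_RCOSETS_def'[of R I] by auto
    then show ?thesis using x q(2)[OF i] by (auto simp: p_def)
  qed
  moreover have "I \<subseteq> p 0"
  proof
    fix r assume r: "r \<in> I"
    interpret I: ideal I R by (rule I)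
    interpret Q: primeideal "q 0" "R Quot I" using q(1)[of 0] by simp
    have "I +> r = I" using I.a_rcos_const r by simp
    moreover have "I \<in> q 0"
      using additive_subgroup.zero_closed[OF ideal.axioms(1)[OF Q.is_ideal]] by (simp add: FactRing_def)
    ultimately show "r \<in> p 0" using r I.a_subset by (auto simp: p_def)
  qed
  ultimately show ?thesis by blast
qed

end

lemma std_count_growth:
  fixes I :: "'k::field mpoly set"
  assumes I: "ideal I (poly_ring n)" "graded I" "I \<noteq> carrier (poly_ring n)"
    and dim: "ideal_dim n I = enat D"
  shows std_count_upper: "\<exists>C. \<forall>d. std_count n I d \<le> C * (d + 1) ^ D"
    and std_count_lower: "\<exists>e. \<forall>j. j ^ D \<le> std_count n I (e * j)"
    and ideal_dim_less: "I \<noteq> {0} \<Longrightarrow> D < n"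
proof -
  interpret R: cring "poly_ring n :: 'k mpoly ring" by (rule cring_poly_ring)
  have kd: "krull_dim (poly_ring n Quot I) = enat D" using dim by (simp add: ideal_dim_def)
  \<comment> \<open>\<open>D + 1\<close> independent variables would give a chain of
    \<open>D + 2\<close> primes over \<open>I\<close>, exceeding the dimension.\<close>
  have "\<not> free_vars I Y" if Y: "Y \<subseteq> {1..n}" "card Y = Suc D" for Y
  proof
    assume "free_vars I Y"
    then obtain p where "\<And>i. i \<le> Suc D \<Longrightarrow> primeideal (p i) (poly_ring n)"
      "\<And>i. i < Suc D \<Longrightarrow> p i \<subset> p (Suc i)" "I \<subseteq> p 0"
      using ex_prime_chain[OF I(1,2) Y] by blast
    then have "enat (Suc D) \<le> enat D" using R.krull_dim_quot_geI[OF I(1), of "Suc D" p] kd by simp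
    then show False by simp
  qed
  then obtain C where C: "\<And>d. (d + 1) * std_count n I d \<le> C * (d + 1) ^ Suc D"
    using std_count_le_not_free_vars[OF I(1), of "Suc D"] by blast
  have "std_count n I d \<le> C * (d + 1) ^ D" for d
  proof -
    have "(d + 1) * std_count n I d \<le> (d + 1) * (C * (d + 1) ^ D)" using C[of d] by (simp only: power_Suc mult.left_commute)
    then show ?thesis by (simp only: mult_le_cancel1)
  qed
  then show "\<exists>C. \<forall>d. std_count n I d \<le> C * (d + 1) ^ D" by blast
  show lower: "\<exists>e. \<forall>j. j ^ D \<le> std_count n I (e * j)"
  proof (cases "D = 0")
    case True
    \<comment> \<open>Here \<open>j ^ 0 = 1\<close>, and properness makes 1 a standard term.\<close>
    then show ?thesis using std_count_ge_1[OF I(1,3)] by auto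
  next
    case False
    then obtain p where p: "\<And>i. i \<le> D \<Longrightarrow> primeideal (p i) (poly_ring n)"
      "\<And>i. i < D \<Longrightarrow> p i \<subset> p (Suc i)" "I \<subseteq> p 0"
      using R.ex_prime_chain_krull_dim[OF I(1) kd] by blast
    obtain e where "\<And>j. j ^ D \<le> std_count n (p 0) (e * j)" using std_count_ge_chain[of D p, OF p(1,2)] by blast
    then show ?thesis using std_count_antimono[OF p(3), of n] le_trans by blast
  qed
  \<comment> \<open>A nonzero ideal leaves no \<open>n\<close> variables free, so its count grows
    with order below \<open>n\<close>, while the lower bound forces order \<open>D\<close>.\<close>
  show "D < n" if "I \<noteq> {0}"
  proof (rule ccontr)
    assume "\<not> D < n"
    have nf: "\<not> free_vars I Y" if "Y \<subseteq> {1..n}" "card Y = n" for Y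
    proof -
      have "Y = {1..n}" using that card_subset_eq[of "{1..n}" Y] by simp
      then have "I \<subseteq> polys_over Y" using ideal_carrier[OF I(1)] by (auto simp: poly_ring_def)
      then show ?thesis using \<open>I \<noteq> {0}\<close> ideal_0[OF I(1)] by (auto simp: free_vars_def)
    qed
    obtain C where C: "\<And>d. (d + 1) * std_count n I d \<le> C * (d + 1) ^ n"
      using std_count_le_not_free_vars[OF I(1) nf] by blast
    obtain e0 where e0: "\<And>j. j ^ D \<le> std_count n I (e0 * j)" using lower by blast
    \<comment> \<open>With \<open>e\<close> positive, \<open>e * j + 1\<close> is at most
      \<open>2 * e * j\<close>; \<open>j\<close> is chosen one above the constant that would bound
      it.\<close>
    define e where "e = Suc e0"
    define j where "j = Suc (C * (2 * e) ^ n)"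
    have "0 < e * j" by (simp add: e_def j_def)
    then have ej: "e * j + 1 \<le> 2 * e * j" by simp
    have "j * j ^ n \<le> (e * j + 1) * j ^ D"
    proof (rule mult_mono)
      show "j ^ n \<le> j ^ D" using \<open>\<not> D < n\<close> by (intro power_increasing) (auto simp: j_def)
    qed (simp_all add: e_def)
    also have "\<dots> \<le> (e * j + 1) * std_count n I (e * j)"
      by (intro mult_left_mono le_trans[OF e0[of j]] std_count_mono) (simp_all add: e_def)
    also have "\<dots> \<le> C * (e * j + 1) ^ n" by (rule C)
    also have "\<dots> \<le> C * (2 * e * j) ^ n"
      by (intro mult_left_mono power_mono ej) simp_all
    also have "\<dots> = C * (2 * e) ^ n * j ^ n" by (simp add: power_mult_distrib)
    finally have "j * j ^ n \<le> C * (2 * e) ^ n * j ^ n" by simp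
    moreover have "0 < j ^ n" by (simp add: j_def)
    ultimately have "j \<le> C * (2 * e) ^ n" by (simp only: mult_le_cancel2)
    then show False by (simp add: j_def)
  qed
qed

section \<open>The Hilbert function\<close>

text \<open>The dimension in \<open>quot_dim\<close> is taken over the image of these constants in
  the quotient, which must be a subfield.\<close>

lemma subfield_constants:
  "subfield (range (\<lambda>c. monomial c 0)) (poly_ring n :: 'k::field mpoly ring)"
proof -
  interpret R: cring "poly_ring n :: 'k mpoly ring" by (rule cring_poly_ring)
  let ?K = "range (\<lambda>c. monomial c 0) :: 'k mpoly set"
  have sub: "?K \<subseteq> carrier (poly_ring n)" by auto
  have "subring ?K (poly_ring n)"
  proof (rule R.subringI[OF sub])
    show "\<one>\<^bsub>poly_ring n\<^esub> \<in> ?K" by (auto intro: image_eqI[of _ _ 1])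
    show "\<ominus>\<^bsub>poly_ring n\<^esub> h \<in> ?K" if "h \<in> ?K" for h
      using that by (auto simp: single_uminus[symmetric])
    show "h1 \<otimes>\<^bsub>poly_ring n\<^esub> h2 \<in> ?K" "h1 \<oplus>\<^bsub>poly_ring n\<^esub> h2 \<in> ?K"
      if "h1 \<in> ?K" "h2 \<in> ?K" for h1 h2
      using that by (auto simp: mult_single single_add[symmetric])
  qed
  then have "subcring ?K (poly_ring n)"
    by (rule R.subcringI')
  moreover have "Units (poly_ring n\<lparr>carrier := ?K\<rparr>) = ?K - {\<zero>\<^bsub>poly_ring n\<^esub>}"
  proof (intro equalityI subsetI)
    fix h assume "h \<in> ?K - {\<zero>\<^bsub>poly_ring n\<^esub>}"
    then obtain c where c: "h = monomial c 0" "c \<noteq> 0" by auto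
    then have "monomial (inverse c) 0 * h = 1" "h * monomial (inverse c) 0 = 1"
      by (simp_all add: mult_single)
    then show "h \<in> Units (poly_ring n\<lparr>carrier := ?K\<rparr>)"
      unfolding Units_def using c by (auto intro!: exI[of _ "inverse c"])
  qed (auto simp: Units_def)
  ultimately show ?thesis by (rule R.subfieldI)
qed

section \<open>Dimensions in the quotient ring as numbers of standard terms\<close>

context
  fixes n :: nat and I :: "'k::field mpoly set"
  assumes I: "ideal I (poly_ring n)" and ne: "I \<noteq> carrier (poly_ring n)"
begin

interpretation I: ideal I "poly_ring n" by (rule I)
interpretation Q: ring "poly_ring n Quot I" by (rule I.quotient_is_ring)
interpretation h: ring_hom_ring "poly_ring n" "poly_ring n Quot I" "residue n I"
  using I.rcos_ring_hom_ring by (simp add: residue_def[abs_def])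

lemma residue_eq_iff:
  assumes "f \<in> carrier (poly_ring n)" "g \<in> carrier (poly_ring n)"
  shows "residue n I f = residue n I g \<longleftrightarrow> f - g \<in> I"
proof -
  have "residue n I f = residue n I g \<longleftrightarrow> f \<ominus>\<^bsub>poly_ring n\<^esub> g \<in> I"
    using I.quotient_eq_iff_same_a_r_cos[OF I assms] by (simp add: residue_def)
  then show ?thesis using assms by (simp add: a_minus_def)
qed

abbreviation (input) quot_consts :: "'k mpoly set set" where
  "quot_consts \<equiv> range (\<lambda>c. residue n I (monomial c 0))"

lemma subfield_quot_consts: "subfield quot_consts (poly_ring n Quot I)"
proof -
  \<comment> \<open>Properness keeps the quotient nontrivial, so the image of the field of constants
    is again a field.\<close>
  have "\<one>\<^bsub>poly_ring n Quot I\<^esub> \<noteq> \<zero>\<^bsub>poly_ring n Quot I\<^esub>"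
  proof
    assume "\<one>\<^bsub>poly_ring n Quot I\<^esub> = \<zero>\<^bsub>poly_ring n Quot I\<^esub>"
    then have "residue n I 1 = residue n I 0" using h.hom_one h.hom_zero by simp
    then have "1 \<in> I" by (simp add: residue_eq_iff mem_carrier_iff)
    then show False using I.one_imp_carrier ne by simp
  qed
  from h.img_is_subfield(2)[OF subfield_constants this] show ?thesis by (simp add: image_image)
qed

text \<open>If the residue of a new standard term lay in the span of the others, a nonzero element
  of \<open>I\<close> would be supported on standard terms. Hence each term raises the dimension by
  one.\<close>

lemma dimension_residue_image:
  assumes "finite A" "A \<subseteq> exps n" "A \<inter> lead_expos I = {}"
  shows "Q.dimension (card A) quot_consts (residue n I ` {f. supp f \<subseteq> A})"
  using assms
proof (induction A)
  case empty
  have "{f :: 'k mpoly. supp f \<subseteq> {}} = {0}" by auto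
  then show ?case using h.hom_zero Q.zero_dim by simp
next
  case (insert x A)
  let ?E = "residue n I ` {f. supp f \<subseteq> A}"
  let ?v = "residue n I (monomial 1 x)"
  have x: "x \<in> exps n" and A: "A \<subseteq> exps n" using insert.prems by auto
  have carr: "f \<in> carrier (poly_ring n)" if "supp f \<subseteq> A" for f :: "'k mpoly"
    using that A by (auto simp: mem_carrier_iff)
  have "?v \<notin> ?E"
  proof
    assume "?v \<in> ?E"
    then obtain f where f: "supp f \<subseteq> A" "?v = residue n I f" by auto
    then have "monomial 1 x - f \<in> I" using residue_eq_iff[of "monomial 1 x" f] carr x by simp
    moreover have "supp (monomial 1 x - f) \<subseteq> insert x A"
      using f(1) by (auto simp: in_keys_iff lookup_minus lookup_single when_def split: if_splits)
    ultimately have "monomial 1 x - f = 0"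
      using insert.prems(2) by (intro supp_disjoint_lead_expos[of _ I]) auto
    then have "f = monomial 1 x" by simp
    then show False using f(1) insert.hyps(2) by simp
  qed
  moreover have "?v \<in> carrier (poly_ring n Quot I)" using x by (intro h.hom_closed) simp
  ultimately have "Q.dimension (Suc (card A)) quot_consts (Q.line_extension quot_consts ?v ?E)"
    using insert.IH insert.prems by (intro Q.Suc_dim) auto
  moreover have "Q.line_extension quot_consts ?v ?E = residue n I ` {f. supp f \<subseteq> insert x A}"
  proof -
    have lin: "residue n I (monomial c 0) \<otimes>\<^bsub>poly_ring n Quot I\<^esub> ?v \<oplus>\<^bsub>poly_ring n Quot I\<^esub> residue n I f
        = residue n I (monomial c x + f)" if "supp f \<subseteq> A" for c f
    proof -
      have "residue n I (monomial c x) = residue n I (monomial c 0) \<otimes>\<^bsub>poly_ring n Quot I\<^esub> ?v"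
        using h.hom_mult[of "monomial c 0" "monomial 1 x"] x by (simp add: mult_single)
      then show ?thesis using h.hom_add[of "monomial c x" f] carr[OF that] x by simp
    qed
    have "Q.line_extension quot_consts ?v ?E
      = {residue n I (monomial c 0) \<otimes>\<^bsub>poly_ring n Quot I\<^esub> ?v \<oplus>\<^bsub>poly_ring n Quot I\<^esub> residue n I f
          |c f. supp f \<subseteq> A}"
      unfolding Q.line_extension_def set_add_def' r_coset_def by blast
    also have "\<dots> = {residue n I (monomial c x + f) |c f. supp f \<subseteq> A}"
      using lin by (intro Collect_cong) metis
    also have "\<dots> = residue n I ` {f. supp f \<subseteq> insert x A}"
    proof (intro equalityI subsetI)
      fix y assume "y \<in> residue n I ` {f. supp f \<subseteq> insert x A}"
      then obtain f where f: "supp f \<subseteq> insert x A" "y = residue n I f" by auto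
      have "supp (f - monomial (lookup f x) x) \<subseteq> A"
        using f(1) by (auto simp: in_keys_iff lookup_minus lookup_single when_def split: if_splits)
      moreover have "f = monomial (lookup f x) x + (f - monomial (lookup f x) x)" by simp
      ultimately show "y \<in> {residue n I (monomial c x + f) |c f. supp f \<subseteq> A}"
        using f(2) by (metis (mono_tags, lifting) mem_Collect_eq)
    next
      fix y assume "y \<in> {residue n I (monomial c x + f) |c f. supp f \<subseteq> A}"
      then obtain c f where f: "supp f \<subseteq> A" "y = residue n I (monomial c x + f)" by auto
      have "supp (monomial c x + f) \<subseteq> insert x A"
        using f(1) Poly_Mapping.keys_add[of "monomial c x" f] by (auto split: if_splits)
      then show "y \<in> residue n I ` {f. supp f \<subseteq> insert x A}" using f(2) by blast
    qed
    finally show ?thesis .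
  qed
  ultimately show ?case using insert.hyps by simp
qed

text \<open>The last assumption replaces each element of \<open>V\<close> by a normal form with the
  same residue.\<close>

lemma quot_dim_eq_card:
  assumes A: "finite A" "A \<subseteq> exps n" "A \<inter> lead_expos I = {}"
    and V: "V \<subseteq> carrier (poly_ring n)" "{f. supp f \<subseteq> A} \<subseteq> V"
      "\<And>f. f \<in> V \<Longrightarrow> \<exists>w\<in>I. supp (f - w) \<subseteq> A"
  shows "quot_dim n I V = card A"
proof -
  have "residue n I ` V = residue n I ` {f. supp f \<subseteq> A}"
  proof (intro equalityI subsetI)
    fix y assume "y \<in> residue n I ` V"
    then obtain f where f: "f \<in> V" "y = residue n I f" by auto
    obtain w where w: "w \<in> I" "supp (f - w) \<subseteq> A" using V(3)[OF f(1)] by auto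
    then have "residue n I f = residue n I (f - w)"
      using V(1) f(1) A(2) by (subst residue_eq_iff) (auto simp: mem_carrier_iff[of "f - w"])
    then show "y \<in> residue n I ` {f. supp f \<subseteq> A}" using f(2) w(2) by blast
  qed (use V(2) in auto)
  then show ?thesis
    unfolding quot_dim_def
    using Q.dimI[OF subfield_quot_consts dimension_residue_image[OF A]] by (simp add: over_def)
qed

lemma hilbert_function_eq:
  assumes gr: "graded I"
  shows "hilbert_function n I d = card ({\<alpha> \<in> exps n. tdeg \<alpha> = d} - lead_expos I)"
  unfolding hilbert_function_def
proof (rule quot_dim_eq_card)
  let ?M = "{\<alpha> \<in> exps n. tdeg \<alpha> = d}"
  have fin: "finite ?M" by (rule finite_subset[OF _ finite_terms[of n d]]) (auto simp: terms_def)
  then show "finite (?M - lead_expos I)" by simp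
  show "\<exists>w\<in>I. supp (f - w) \<subseteq> ?M - lead_expos I"
    if f: "f \<in> {f \<in> carrier (poly_ring n). homogeneous_of d f}" for f
  proof -
    define W where "W = I \<inter> {f. supp f \<subseteq> ?M}"
    have W: "mp.subspace W"
      unfolding W_def using mp.subspace_inter[OF subspace_ideal[OF I] subspace_supp] .
    obtain w where w: "w \<in> W" "supp (f - w) \<subseteq> ?M - lead_expos W"
      using ex_normal_form[OF fin W, of f] f by (auto simp: W_def mem_carrier_iff homogeneous_of_def)
    \<comment> \<open>The reduction uses only the degree \<open>d\<close> part \<open>W\<close> of
      \<open>I\<close>. This loses no leading exponent of degree \<open>d\<close>: the degree
      \<open>d\<close> component of such an element stays in the graded ideal and keeps the leading
      exponent.\<close>
    have "?M \<inter> lead_expos I \<subseteq> lead_expos W"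
    proof
      fix \<alpha> assume \<alpha>: "\<alpha> \<in> ?M \<inter> lead_expos I"
      then obtain g where g: "g \<in> I" "g \<noteq> 0" "lead_expo g = \<alpha>" by (auto elim: lead_exposE)
      have "hcomp d g \<in> W"
        using gr g(1) ideal_supp[OF I g(1)] by (auto simp: graded_def W_def supp_restr)
      moreover have "lead_expo (hcomp d g) = \<alpha>"
        using \<alpha> g lead_expo[OF g(2)] by (intro lead_expoI) (auto simp: supp_restr)
      moreover have "\<alpha> \<in> supp (hcomp d g)" using \<alpha> g lead_expo_in[OF g(2)] by (auto simp: supp_restr)
      ultimately show "\<alpha> \<in> lead_expos W" using lead_exposI[of "hcomp d g" W] by (metis empty_iff keys_zero)
    qed
    then show ?thesis using w by (auto simp: W_def)
  qed
qed (auto simp: mem_carrier_iff homogeneous_of_def)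

lemma hilbert_function_std_count:
  assumes "graded I"
  shows "std_count n I (Suc d) = std_count n I d + hilbert_function n I (Suc d)"
proof -
  have "terms n (Suc d) - lead_expos I
      = (terms n d - lead_expos I) \<union> ({\<alpha> \<in> exps n. tdeg \<alpha> = Suc d} - lead_expos I)"
    by (auto simp: terms_def)
  moreover have "finite {\<alpha> \<in> exps n. tdeg \<alpha> = Suc d}"
    by (rule finite_subset[OF _ finite_terms[of n "Suc d"]]) (auto simp: terms_def)
  ultimately show ?thesis
    unfolding hilbert_function_eq[OF assms] std_count_def
    by (simp only:) (intro card_Un_disjoint, auto simp: terms_def[of n d] intro: finite_Diff[OF finite_terms, unfolded terms_def])
qed

text \<open>A constant count means that no standard term has degree above \<open>d0\<close>, since
  nested finite sets of equal size coincide. This serves the case of dimension 0.\<close>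

lemma quot_dim_carrier:
  assumes const: "\<And>d. d \<ge> d0 \<Longrightarrow> std_count n I d = m"
  shows "quot_dim n I (carrier (poly_ring n)) = m"
proof -
  let ?A = "terms n d0 - lead_expos I"
  have A: "terms n d - lead_expos I \<subseteq> ?A" for d
  proof (cases "d \<le> d0")
    case True
    then show ?thesis using terms_mono by auto
  next
    case False
    have "?A = terms n d - lead_expos I"
    proof (rule card_subset_eq)
      show "?A \<subseteq> terms n d - lead_expos I" using False terms_mono[of d0 d n] by auto
      show "card ?A = card (terms n d - lead_expos I)"
        using const[of d] const[of d0] False by (simp add: std_count_def)
    qed simp
    then show ?thesis by simp
  qed
  have "quot_dim n I (carrier (poly_ring n)) = card ?A"
  proof (rule quot_dim_eq_card)
    show "finite ?A" by simp
    fix f :: "'k mpoly" assume f: "f \<in> carrier (poly_ring n)"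
    let ?d = "tdeg (lead_expo f)"
    obtain w where "w \<in> trunc_ideal n I ?d" "supp (f - w) \<subseteq> terms n ?d - lead_expos (trunc_ideal n I ?d)"
      using ex_normal_form[OF finite_terms subspace_trunc_ideal[OF I, of ?d] _ supp_subset_terms[OF f]]
      by (auto simp: trunc_ideal_def)
    then show "\<exists>w\<in>I. supp (f - w) \<subseteq> ?A"
      using A[of ?d] unfolding lead_expos_trunc_ideal[OF I] by (auto simp: trunc_ideal_def)
  qed (auto simp: terms_def mem_carrier_iff)
  then show ?thesis using const[of d0] by (simp add: std_count_def)
qed

end

section \<open>Numerical polynomials\<close>

text \<open>The polynomial \<open>(x + 1) ... (x + i) / i!\<close>, with value
  \<open>(d + i) choose i\<close> at \<open>d\<close>.\<close>

fun binom_poly :: "nat \<Rightarrow> 'a::field_char_0 poly" where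
  "binom_poly 0 = 1"
| "binom_poly (Suc i) = Polynomial.smult (inverse (of_nat (Suc i))) ([:of_nat (Suc i), 1:] * binom_poly i)"

lemma poly_binom_poly: "poly (binom_poly i) (of_nat d) = (of_nat ((d + i) choose i) :: 'a::field_char_0)"
proof (induction i)
  case (Suc i)
  have "of_nat (Suc i) * of_nat (Suc (d + i) choose Suc i)
      = (of_nat (Suc (d + i)) * of_nat ((d + i) choose i) :: 'a)"
    using Suc_times_binomial[of i "d + i"] by (metis of_nat_mult)
  then have "of_nat (Suc (d + i) choose Suc i)
      = (inverse (of_nat (Suc i)) * (of_nat (Suc (d + i)) * of_nat ((d + i) choose i)) :: 'a)"
    by (simp add: field_simps del: of_nat_Suc binomial_Suc_Suc)
  also have "of_nat (Suc (d + i)) = (of_nat (Suc i) + of_nat d :: 'a)" by simp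
  finally show ?case
    by (simp only: binom_poly.simps poly_smult poly_mult Suc add_Suc_right) simp
qed simp

lemma binom_poly_degree_lead_coeff:
  shows degree_binom_poly: "degree (binom_poly i :: 'a::field_char_0 poly) = i"
    and lead_coeff_binom_poly: "lead_coeff (binom_poly i :: 'a poly) = inverse (fact i)"
proof -
  have "degree (binom_poly i :: 'a poly) = i \<and> lead_coeff (binom_poly i :: 'a poly) = inverse (fact i)"
  proof (induction i)
    case (Suc i)
    let ?b = "binom_poly i :: 'a poly"
    have nz: "?b \<noteq> 0" using Suc by auto
    have b: "degree ?b = i" "Polynomial.coeff ?b i = inverse (fact i)" using Suc by auto
    define p where "p = [:of_nat (Suc i), 1:] * ?b"
    have "lead_coeff p = inverse (fact i)"
      unfolding p_def by (subst lead_coeff_mult) (simp add: b)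
    moreover have "degree p = Suc i"
      unfolding p_def using b nz by (subst degree_mult_eq) auto
    moreover have "binom_poly (Suc i) = Polynomial.smult (inverse (of_nat (Suc i))) p"
      by (simp only: binom_poly.simps p_def)
    ultimately show ?case
      by (simp del: binom_poly.simps of_nat_Suc add: field_simps)
  qed simp
  then show "degree (binom_poly i :: 'a poly) = i" "lead_coeff (binom_poly i :: 'a poly) = inverse (fact i)"
    by auto
qed

text \<open>\<open>binom_poly i\<close> has degree \<open>i\<close>, so the last nonzero coefficient
  alone decides.\<close>

lemma sum_binom_poly:
  fixes a :: "nat \<Rightarrow> 'a::field_char_0"
  assumes "m \<le> n" "a m \<noteq> 0" "\<And>i. m < i \<Longrightarrow> i \<le> n \<Longrightarrow> a i = 0"
  defines "q \<equiv> \<Sum>i\<le>n. Polynomial.smult (a i) (binom_poly i)"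
  shows "degree q = m" "lead_coeff q = a m / fact m"
proof -
  have coeff0: "Polynomial.coeff q k = 0" if "m < k" for k
    unfolding q_def coeff_sum
  proof (intro sum.neutral ballI)
    fix i assume i: "i \<in> {..n}"
    show "Polynomial.coeff (Polynomial.smult (a i) (binom_poly i)) k = 0"
      using assms(3)[of i] i that by (cases "m < i") (auto intro: coeff_eq_0 simp: degree_binom_poly)
  qed
  have "Polynomial.coeff q m = (\<Sum>i\<in>{m}. a i * Polynomial.coeff (binom_poly i) m)"
    unfolding q_def coeff_sum coeff_smult
  proof (intro sum.mono_neutral_right ballI)
    fix i assume i: "i \<in> {..n} - {m}"
    show "a i * Polynomial.coeff (binom_poly i) m = 0"
      using assms(3)[of i] i by (cases "m < i") (auto intro: coeff_eq_0 simp: degree_binom_poly)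
  qed (use assms(1) in auto)
  then have cm: "Polynomial.coeff q m = a m / fact m"
    using lead_coeff_binom_poly[of m, where 'a = 'a] by (simp add: degree_binom_poly field_simps)
  have "degree q \<le> m" using coeff0 by (intro degree_le) auto
  moreover have "m \<le> degree q" using cm assms(2) by (intro le_degree) simp
  ultimately show "degree q = m" by simp
  then show "lead_coeff q = a m / fact m" using cm by simp
qed

lemma real_poly_pos_at_nats:
  assumes "lead_coeff p > (0 :: real)"
  shows "\<exists>N. \<forall>d\<ge>N. poly p (real d) > 0"
proof -
  obtain x where x: "\<forall>y\<ge>x. poly p y \<ge> lead_coeff p" using poly_pinfty_gt_lc[OF assms] by blast
  have "poly p (real d) > 0" if "d \<ge> nat \<lceil>x\<rceil>" for d
  proof -
    have "real d \<ge> x" using that by linarith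
    then show ?thesis using x assms by fastforce
  qed
  then show ?thesis by blast
qed

text \<open>The index \<open>m\<close> of the last nonzero coefficient is the degree of the
  polynomial that represents \<open>F\<close>. The upper bound forces \<open>m \<le> D\<close>, the
  lower bound \<open>D \<le> m\<close>.\<close>

lemma binomial_sum_growth:
  fixes a :: "nat \<Rightarrow> int" and F :: "nat \<Rightarrow> nat"
  assumes F: "\<And>d. d \<ge> d0 \<Longrightarrow> int (F d) = (\<Sum>i\<le>n. a i * int ((d + i) choose i))"
    and upper: "\<And>d. F d \<le> C * (d + 1) ^ D" and lower: "\<And>j. j ^ D \<le> F (e * j)" and mono: "mono F"
  shows "D \<le> n" "a D \<noteq> 0" "\<And>i. D < i \<Longrightarrow> i \<le> n \<Longrightarrow> a i = 0"
proof -
  define q :: "real poly" where "q = (\<Sum>i\<le>n. Polynomial.smult (of_int (a i)) (binom_poly i))"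
  have q: "poly q (real d) = real (F d)" if "d \<ge> d0" for d
  proof -
    have "real (F d) = of_int (int (F d))" by simp
    then show ?thesis unfolding F[OF that] q_def by (simp add: poly_sum poly_binom_poly)
  qed
  \<comment> \<open>If all coefficients vanished, \<open>F\<close> would be eventually 0, against
    \<open>1 \<le> F e\<close> and monotonicity.\<close>
  have "\<exists>i\<le>n. a i \<noteq> 0"
  proof (rule ccontr)
    assume "\<not> (\<exists>i\<le>n. a i \<noteq> 0)"
    then have z: "F d = 0" if "d \<ge> d0" for d using F[OF that] by simp
    have "1 ^ D \<le> F (e * 1)" by (rule lower)
    also have "\<dots> \<le> F (max d0 e)" using mono by (auto simp: mono_def)
    finally show False using z[of "max d0 e"] by simp
  qed
  then obtain m where m: "m \<le> n" "a m \<noteq> 0" "\<And>i. m < i \<Longrightarrow> i \<le> n \<Longrightarrow> a i = 0"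
    using Max_in[of "{i. i \<le> n \<and> a i \<noteq> 0}"] Max_ge[of "{i. i \<le> n \<and> a i \<noteq> 0}"]
    by (metis (mono_tags, lifting) bounded_nat_set_is_finite empty_Collect_eq finite_nat_set_iff_bounded_le leD mem_Collect_eq)
  have deg: "degree q = m" "lead_coeff q = of_int (a m) / fact m"
    using sum_binom_poly[of m n "\<lambda>i. real_of_int (a i)"] m by (simp_all add: q_def)
  \<comment> \<open>The values of \<open>q\<close> at large arguments are natural numbers, which
    excludes a negative leading coefficient.\<close>
  have lc: "lead_coeff q > 0"
  proof (rule ccontr)
    assume "\<not> lead_coeff q > 0"
    moreover have "lead_coeff q \<noteq> 0" using m(2) deg(2) by simp
    ultimately have "lead_coeff (- q) > 0" by (simp only: lead_coeff_minus)
    then obtain N where "\<forall>d\<ge>N. poly (- q) (real d) > 0" using real_poly_pos_at_nats by blast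
    then have "poly (- q) (real (max N d0)) > 0" by simp
    then show False using q[of "max N d0"] by simp
  qed
  have "m \<le> D"
  proof (rule ccontr)
    assume "\<not> m \<le> D"
    \<comment> \<open>The upper bound as a polynomial; if \<open>m > D\<close>, then
      \<open>q\<close> has larger degree and eventually exceeds it.\<close>
    define r where "r = Polynomial.smult (real C) ([:1, 1:] ^ D)"
    have "degree r < degree q"
      using \<open>\<not> m \<le> D\<close> degree_smult_le[of "real C" "[:1, 1:] ^ D"] by (simp add: r_def deg degree_power_eq)
    then have "lead_coeff (q - r) = lead_coeff q" "lead_coeff (q - r) > 0"
      using lc lead_coeff_add_le[of "- r" q] by (simp_all add: degree_add_eq_right add.commute)
    then obtain N where "\<forall>d\<ge>N. poly (q - r) (real d) > 0" using real_poly_pos_at_nats by blast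
    then have "poly (q - r) (real (max N d0)) > 0" by simp
    then have "real C * (real (max N d0) + 1) ^ D < real (F (max N d0))"
      using q[of "max N d0"] by (simp add: r_def poly_power add.commute[of 1])
    also have "\<dots> \<le> real (C * (max N d0 + 1) ^ D)" using upper by (simp only: of_nat_le_iff)
    also have "\<dots> = real C * (real (max N d0) + 1) ^ D"
      by (simp only: of_nat_mult of_nat_power of_nat_add of_nat_1)
    finally show False by simp
  qed
  moreover have "D \<le> m"
  proof (rule ccontr)
    assume "\<not> D \<le> m"
    \<comment> \<open>Compares \<open>F (e * d)\<close> with \<open>d ^ D\<close>. The factor
      \<open>Suc e\<close> keeps the argument at least \<open>d0\<close> even for
      \<open>e = 0\<close>, and monotonicity absorbs the change.\<close>
    define r where "r = q \<circ>\<^sub>p [:0, real (Suc e):]"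
    have "degree r < D" using \<open>\<not> D \<le> m\<close> by (simp add: r_def deg degree_pcompose)
    then have "lead_coeff (Polynomial.monom 1 D - r) > 0"
      using lead_coeff_add_le[of "- r" "Polynomial.monom 1 D"] by (simp add: degree_monom_eq add.commute)
    then obtain N where "\<forall>d\<ge>N. poly (Polynomial.monom 1 D - r) (real d) > 0" using real_poly_pos_at_nats by blast
    then have pos: "poly (Polynomial.monom 1 D - r) (real (max N d0)) > 0" by simp
    let ?d = "max N d0"
    have "poly r (real ?d) = poly q (real (Suc e * ?d))" by (simp add: r_def poly_pcompose algebra_simps)
    also have "\<dots> = real (F (Suc e * ?d))" by (rule q) simp
    finally have "real (F (Suc e * ?d)) < real (?d ^ D)" using pos by (simp add: poly_monom)
    moreover have "F (e * ?d) \<le> F (Suc e * ?d)" using mono by (auto simp: mono_def)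
    ultimately show False using lower[of ?d] by (simp only: of_nat_less_iff)
  qed
  ultimately have "m = D" by simp
  then show "D \<le> n" "a D \<noteq> 0" "\<And>i. D < i \<Longrightarrow> i \<le> n \<Longrightarrow> a i = 0" using m by auto
qed

section \<open>Pommaret bases\<close>

text \<open>Leading exponents are closed under shifts, so the polynomials supported on them form an
  ideal; it contains all leading terms and is generated by them.\<close>

lemma leading_ideal_eq:
  fixes I :: "'k::field mpoly set"
  assumes I: "ideal I (poly_ring n)"
  shows "leading_ideal n I = {f. supp f \<subseteq> lead_expos I}"
proof -
  interpret R: cring "poly_ring n :: 'k mpoly ring" by (rule cring_poly_ring)
  let ?L = "{f. supp f \<subseteq> lead_expos I} :: 'k mpoly set"
  have le: "lead_expos I \<subseteq> exps n" using lead_expos_subset[OF ideal_supp[OF I]] .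
  have LT: "LT ` (I - {0}) \<subseteq> carrier (poly_ring n)"
    using le by (auto simp: LT_def mem_carrier_iff lead_expos_def)
  have "ideal ?L (poly_ring n)"
  proof (rule poly_ring_idealI)
    show "?L \<subseteq> carrier (poly_ring n)" using le by (auto simp: mem_carrier_iff)
    show "f + g \<in> ?L" if "f \<in> ?L" "g \<in> ?L" for f g
      using that Poly_Mapping.keys_add[of f g] by auto
    show "p * f \<in> ?L" if "f \<in> ?L" "p \<in> carrier (poly_ring n)" for f p
    proof -
      have "\<gamma> \<in> lead_expos I" if \<gamma>: "\<gamma> \<in> supp (p * f)" for \<gamma>
      proof -
        obtain \<alpha> \<beta> where "\<alpha> \<in> supp p" "\<beta> \<in> supp f" "\<gamma> = \<alpha> + \<beta>"
          using \<gamma> keys_mult[of p f] by blast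
        then show ?thesis
          using \<open>f \<in> ?L\<close> \<open>p \<in> carrier (poly_ring n)\<close> lead_expos_ideal_add[OF I]
          by (auto simp: mem_carrier_iff)
      qed
      then show ?thesis by auto
    qed
  qed simp
  moreover have "LT ` (I - {0}) \<subseteq> ?L" by (auto simp: LT_def lead_expos_def)
  ultimately have "leading_ideal n I \<subseteq> ?L"
    unfolding leading_ideal_def by (rule R.genideal_minimal)
  moreover have "?L \<subseteq> leading_ideal n I"
  proof
    fix f assume f: "f \<in> ?L"
    have li: "ideal (leading_ideal n I) (poly_ring n)"
      unfolding leading_ideal_def by (rule R.genideal_ideal[OF LT])
    have "monomial 1 \<alpha> \<in> leading_ideal n I" if "\<alpha> \<in> lead_expos I" for \<alpha>
      using that R.genideal_self[OF LT] by (auto simp: leading_ideal_def lead_expos_def LT_def)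
    then have "monomial (lookup f \<alpha>) 0 * monomial 1 \<alpha> \<in> leading_ideal n I" if "\<alpha> \<in> supp f" for \<alpha>
      using f that by (intro ideal_mult[OF li]) auto
    then have "(\<Sum>\<alpha>\<in>supp f. monomial (lookup f \<alpha>) \<alpha>) \<in> leading_ideal n I"
      by (intro ideal_sum[OF li]) (simp add: mult_single)
    then show "f \<in> leading_ideal n I" by (simp flip: poly_eq_sum_monomials)
  qed
  ultimately show ?thesis by blast
qed

definition cone_terms :: "nat \<Rightarrow> 'a::zero mpoly \<Rightarrow> expo set" where
  "cone_terms n h = {lead_expo h + \<gamma> |\<gamma>. vars \<gamma> \<subseteq> XP n h}"

lemma pommaret_cone_supp:
  assumes "f \<in> pommaret_cone n h"
  shows "supp f \<subseteq> cone_terms n (h :: 'a::comm_ring_1 mpoly)"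
proof -
  obtain p where p: "f = monomial 1 (lead_expo h) * p" "p \<in> polys_over (XP n h)"
    using assms by (auto simp: pommaret_cone_def LT_def mult.commute)
  then show ?thesis by (auto simp: supp_monomial_mult cone_terms_def polys_over_def)
qed

lemma monomial_in_pommaret_cone:
  assumes "\<alpha> \<in> cone_terms n h"
  shows "monomial c \<alpha> \<in> pommaret_cone n (h :: 'a::comm_ring_1 mpoly)"
proof -
  obtain \<gamma> where "\<alpha> = lead_expo h + \<gamma>" "vars \<gamma> \<subseteq> XP n h" using assms by (auto simp: cone_terms_def)
  then have "monomial c \<alpha> = monomial c \<gamma> * LT h" "monomial c \<gamma> \<in> polys_over (XP n h)"
    by (auto simp: LT_def mult_single add.commute polys_over_def)
  then show ?thesis by (auto simp: pommaret_cone_def)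
qed

lemma zero_in_pommaret_cone: "0 \<in> pommaret_cone n h"
  unfolding pommaret_cone_def by (intro CollectI exI[of _ 0]) (simp add: polys_over_def)

section \<open>Partition of the leading exponents into the cones of a Pommaret basis\<close>

context
  fixes n :: nat and I H :: "'k::field mpoly set"
  assumes I: "ideal I (poly_ring n)" and ne: "I \<noteq> carrier (poly_ring n)"
    and H: "pommaret_basis n I H"
begin

lemma finite_pommaret_basis: "finite H"
  using H by (simp add: pommaret_basis_def)

text \<open>The direct sum is tested on single terms: decomposing a term, some summand must involve
  its exponent; conversely a term in one cone is a sum with a single nonzero summand.\<close>

lemma lead_expos_eq_cones: "lead_expos I = (\<Union>h\<in>H. cone_terms n h)"
proof -
  have ds: "is_direct_sum H (pommaret_cone n) {f. supp f \<subseteq> lead_expos I}"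
    using H leading_ideal_eq[OF I] by (simp add: pommaret_basis_def)
  show ?thesis
  proof (intro equalityI subsetI)
    fix \<alpha> assume "\<alpha> \<in> lead_expos I"
    then have "monomial 1 \<alpha> \<in> {f :: 'k mpoly. supp f \<subseteq> lead_expos I}" by simp
    then have "monomial 1 \<alpha> \<in> {\<Sum>h\<in>H. g h |g. \<forall>h\<in>H. g h \<in> pommaret_cone n h}"
      using ds unfolding is_direct_sum_def by (simp only:)
    then obtain g where g: "monomial 1 \<alpha> = (\<Sum>h\<in>H. g h)" "\<forall>h\<in>H. g h \<in> pommaret_cone n h"
      by blast
    have "(\<Sum>h\<in>H. lookup (g h) \<alpha>) \<noteq> 0"
      using arg_cong[OF g(1), of "\<lambda>f. lookup f \<alpha>"] by (simp add: lookup_sum)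
    then obtain h where "h \<in> H" "lookup (g h) \<alpha> \<noteq> 0" by (rule sum.not_neutral_contains_not_neutral)
    then show "\<alpha> \<in> (\<Union>h\<in>H. cone_terms n h)"
      using g(2) pommaret_cone_supp[of "g h" n h] by (auto simp: in_keys_iff)
  next
    fix \<alpha> assume "\<alpha> \<in> (\<Union>h\<in>H. cone_terms n h)"
    then obtain h where h: "h \<in> H" "\<alpha> \<in> cone_terms n h" by blast
    define g where "g h' = (if h' = h then monomial (1 :: 'k) \<alpha> else 0)" for h'
    have "\<forall>h\<in>H. g h \<in> pommaret_cone n h"
      by (simp add: g_def monomial_in_pommaret_cone[OF h(2)] zero_in_pommaret_cone)
    then have "(\<Sum>h\<in>H. g h) \<in> {\<Sum>h\<in>H. g h |g. \<forall>h\<in>H. g h \<in> pommaret_cone n h}"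
      by blast
    then have "(\<Sum>h\<in>H. g h) \<in> {f. supp f \<subseteq> lead_expos I}"
      using ds unfolding is_direct_sum_def by (simp only:)
    then show "\<alpha> \<in> lead_expos I"
      using h(1) finite_pommaret_basis by (simp add: g_def)
  qed
qed

text \<open>A common exponent would let a term in one cone cancel its negative in the other, a
  nontrivial decomposition of 0.\<close>

lemma cone_terms_disjoint:
  assumes "g \<in> H" "h \<in> H" "g \<noteq> h"
  shows "cone_terms n g \<inter> cone_terms n h = {}"
proof (rule ccontr)
  assume "cone_terms n g \<inter> cone_terms n h \<noteq> {}"
  then obtain \<alpha> where \<alpha>: "\<alpha> \<in> cone_terms n g" "\<alpha> \<in> cone_terms n h" by blast
  define u where "u h' = (if h' = g then monomial (1 :: 'k) \<alpha> else if h' = h then monomial (- 1) \<alpha> else 0)" for h'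
  have "\<forall>h\<in>H. u h \<in> pommaret_cone n h"
    by (simp add: u_def \<alpha> monomial_in_pommaret_cone zero_in_pommaret_cone)
  moreover have "(\<Sum>h\<in>H. u h) = (\<Sum>h\<in>{g, h}. u h)"
    using assms finite_pommaret_basis by (intro sum.mono_neutral_right) (auto simp: u_def)
  then have "(\<Sum>h\<in>H. u h) = 0" using assms(3) by (simp add: u_def single_uminus)
  ultimately have "u g = 0"
    using H assms(1) unfolding pommaret_basis_def is_direct_sum_def by blast
  then show False by (simp add: u_def)
qed

lemma pommaret_basis_mem:
  assumes "h \<in> H"
  shows "h \<in> I" "h \<noteq> 0" "lead_expo h \<in> exps n" "XP n h \<subseteq> {1..n}" "poly_deg h = tdeg (lead_expo h)"
proof -
  show h: "h \<in> I" "h \<noteq> 0" using H assms by (auto simp: pommaret_basis_def)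
  show ex: "lead_expo h \<in> exps n" using ideal_supp[OF I h(1)] lead_expo_in[OF h(2)] by auto
  \<comment> \<open>Properness rules out constant basis elements, so that \<open>cls\<close> is the
    maximum of a nonempty set.\<close>
  have "lead_expo h \<noteq> 0" using zero_notin_lead_expos[OF I ne] lead_exposI[OF h] by metis
  then have "vars (lead_expo h) \<noteq> {}" by simp
  then have "cls (lead_expo h) \<in> vars (lead_expo h)" unfolding cls_def by (intro Max_in) auto
  then have "1 \<le> cls (lead_expo h)" using ex unfolding exps_def by auto
  then show "XP n h \<subseteq> {1..n}" by (auto simp: XP_def mult_vars_def)
  show "poly_deg h = tdeg (lead_expo h)"
    unfolding poly_deg_def using h(2) lead_expo_in[OF h(2)] tdeg_le_lead_expo[of _ h]
    by (auto intro!: Max_eqI)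
qed

lemma card_XP_le: "h \<in> H \<Longrightarrow> card (XP n h) \<le> n"
  using card_mono[OF _ pommaret_basis_mem(4), of h] by simp

text \<open>Subtracting the leading exponent turns the truncated cone into the terms in the
  multiplicative variables up to the remaining degree.\<close>

lemma card_cone_terms:
  assumes h: "h \<in> H" and d: "poly_deg h \<le> d"
  shows "card (cone_terms n h \<inter> terms n d) = (d - poly_deg h + card (XP n h)) choose card (XP n h)"
proof -
  note hh = pommaret_basis_mem[OF h]
  have "cone_terms n h \<inter> terms n d = (+) (lead_expo h) ` var_terms (XP n h) (d - poly_deg h)"
  proof (intro equalityI subsetI)
    fix \<alpha> assume "\<alpha> \<in> (+) (lead_expo h) ` var_terms (XP n h) (d - poly_deg h)"
    then obtain \<gamma> where \<gamma>: "\<alpha> = lead_expo h + \<gamma>" "vars \<gamma> \<subseteq> XP n h" "tdeg \<gamma> \<le> d - poly_deg h"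
      by (auto simp: var_terms_def)
    then have "\<gamma> \<in> exps n" using hh(4) by (auto simp: exps_def)
    then show "\<alpha> \<in> cone_terms n h \<inter> terms n d"
      using \<gamma> hh d by (auto simp: cone_terms_def terms_def tdeg_add)
  qed (auto simp: cone_terms_def terms_def tdeg_add var_terms_def hh(5))
  then have "card (cone_terms n h \<inter> terms n d) = card (var_terms (XP n h) (d - poly_deg h))"
    by (simp add: card_image)
  also have "\<dots> = (d - poly_deg h + card (XP n h)) choose card (XP n h)"
    using finite_subset[OF hh(4)] by (intro card_var_terms) auto
  finally show ?thesis .
qed

text \<open>Each term of degree at most \<open>d\<close> is standard or lies in exactly one cone.
  The bound on the degrees keeps the subtractions exact.\<close>

lemma std_count_pommaret:
  assumes d: "\<And>h. h \<in> H \<Longrightarrow> poly_deg h \<le> d"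
  shows "std_count n I d + (\<Sum>h\<in>H. (d - poly_deg h + card (XP n h)) choose card (XP n h)) = (d + n) choose n"
proof -
  have "lead_expos I \<inter> terms n d = (\<Union>h\<in>H. cone_terms n h \<inter> terms n d)"
    by (auto simp: lead_expos_eq_cones)
  then have "card (lead_expos I \<inter> terms n d) = (\<Sum>h\<in>H. card (cone_terms n h \<inter> terms n d))"
    using finite_pommaret_basis cone_terms_disjoint by (simp only:) (intro card_UN_disjoint, auto)
  also have "\<dots> = (\<Sum>h\<in>H. (d - poly_deg h + card (XP n h)) choose card (XP n h))"
    using d by (intro sum.cong refl card_cone_terms) auto
  finally have "card (lead_expos I \<inter> terms n d) = \<dots>" .
  moreover have "card (terms n d) = (d + n) choose n"
    unfolding terms_eq_var_terms by (subst card_var_terms) auto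
  ultimately show ?thesis
    using card_lead_expos_trunc_ideal[OF I, of d] by (simp add: lead_expos_trunc_ideal[OF I])
qed

end

section \<open>The degree formula\<close>

text \<open>This is the expansion of \<open>t\<^sup>e / (1 - t)\<^bsup>k + 1\<^esup>\<close> after writing \<open>t\<^sup>e = (1 - (1 - t))\<^sup>e\<close>.\<close>

lemma binomial_shift_expansion:
  assumes "e \<le> d"
  shows "int ((d - e + k) choose k) = (\<Sum>i\<le>k. (- 1) ^ (k - i) * int (e choose (k - i)) * int ((d + i) choose i))"
  using assms
proof (induction e arbitrary: k)
  case 0
  have "(\<Sum>i\<le>k. (- 1) ^ (k - i) * int (0 choose (k - i)) * int ((d + i) choose i))
      = (\<Sum>i\<in>{k}. (- 1) ^ (k - i) * int (0 choose (k - i)) * int ((d + i) choose i))"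
    by (intro sum.mono_neutral_right) (auto simp: binomial_eq_0)
  then show ?case by simp
next
  case (Suc e)
  show ?case
  proof (cases k)
    case 0
    then show ?thesis by simp
  next
    case (Suc l)
    define m where "m = d - Suc e"
    have m: "d - e = Suc m" using Suc.prems by (simp add: m_def)
    \<comment> \<open>Pascal's rule: one more factor \<open>t = 1 - (1 - t)\<close> turns the value
      for \<open>k\<close> into the difference of the values for \<open>k\<close> and
      \<open>k - 1\<close>.\<close>
    have "int ((m + Suc l) choose Suc l) = int ((d - e + Suc l) choose Suc l) - int ((d - e + l) choose l)"
      unfolding m by simp
    also have "\<dots> = (\<Sum>i\<le>Suc l. (- 1) ^ (Suc l - i) * int (e choose (Suc l - i)) * int ((d + i) choose i))
        - (\<Sum>i\<le>l. (- 1) ^ (l - i) * int (e choose (l - i)) * int ((d + i) choose i))"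
      using Suc.IH[of l] Suc.IH[of "Suc l"] Suc.prems by simp
    \<comment> \<open>The summand \<open>i = Suc l\<close> occurs only in the first sum, with
      coefficient 1; the others merge by Pascal's rule, their signs being opposite.\<close>
    also have "\<dots> = int ((d + Suc l) choose Suc l)
        + (\<Sum>i\<le>l. (- 1) ^ (Suc l - i) * int (Suc e choose (Suc l - i)) * int ((d + i) choose i))"
    proof -
      have "(- 1) ^ (Suc l - i) * int (e choose (Suc l - i)) * c - (- 1) ^ (l - i) * int (e choose (l - i)) * c
          = (- 1) ^ (Suc l - i) * int (Suc e choose (Suc l - i)) * c" if "i \<le> l" for i c
        using that by (simp add: Suc_diff_le algebra_simps)
      then show ?thesis
        by (simp add: sum_subtractf[symmetric] del: binomial_Suc_Suc)
    qed
    also have "\<dots> = (\<Sum>i\<le>Suc l. (- 1) ^ (Suc l - i) * int (Suc e choose (Suc l - i)) * int ((d + i) choose i))"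
      by simp
    finally show ?thesis by (simp only: Suc m_def)
  qed
qed

text \<open>Two polynomials agreeing at almost all natural numbers are equal, so the definite
  description is determined.\<close>

lemma hilbert_polynomialI:
  assumes "\<forall>\<^sub>F d in sequentially. poly p (of_nat d) = of_nat (hilbert_function n I d)"
  shows "hilbert_polynomial n I = p"
  unfolding hilbert_polynomial_def
proof (rule the_equality)
  fix q :: "rat poly" assume "\<forall>\<^sub>F d in sequentially. poly q (of_nat d) = of_nat (hilbert_function n I d)"
  with assms have "\<forall>\<^sub>F d in sequentially. poly (q - p) (of_nat d) = 0"
    by eventually_elim simp
  then obtain N where N: "\<And>d. d \<ge> N \<Longrightarrow> poly (q - p) (of_nat d) = 0"
    by (auto simp: eventually_sequentially)
  have "infinite (of_nat ` {N..} :: rat set)" by (simp add: finite_image_iff infinite_Ici inj_on_def)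
  moreover have "of_nat ` {N..} \<subseteq> {x. poly (q - p) x = 0}" using N by auto
  ultimately have "infinite {x. poly (q - p) x = 0}" using finite_subset by blast
  then have "q - p = 0" using poly_roots_finite[of "q - p"] by blast
  then show "q = p" by simp
qed (rule assms)

text \<open>By the growth bounds the expansion ends at index \<open>D\<close>. For positive
  \<open>D\<close>, passing from degree at most \<open>d\<close> to degree exactly \<open>d\<close>
  lowers each index by one, so the Hilbert polynomial has leading coefficient
  \<open>a D / fact (D - 1)\<close>.\<close>

lemma ideal_degree_eq_binomial_coefficient:
  fixes I :: "'k::field mpoly set" and a :: "nat \<Rightarrow> int"
  assumes I: "ideal I (poly_ring n)" "graded I" "I \<noteq> carrier (poly_ring n)"
    and dim: "ideal_dim n I = enat D"
    and F: "\<And>d. d \<ge> d0 \<Longrightarrow> int (std_count n I d) = (\<Sum>i\<le>n. a i * int ((d + i) choose i))"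
  shows "ideal_degree n I = of_int (a D)"
proof -
  obtain C e where C: "\<And>d. std_count n I d \<le> C * (d + 1) ^ D" and e: "\<And>j. j ^ D \<le> std_count n I (e * j)"
    using std_count_upper[OF I dim] std_count_lower[OF I dim] by blast
  have mono: "mono (std_count n I)" by (simp add: mono_def std_count_mono)
  note a = binomial_sum_growth[of d0 "std_count n I" a n C D e, OF F C e mono]
  have F': "int (std_count n I d) = (\<Sum>i\<le>D. a i * int ((d + i) choose i))" if "d \<ge> d0" for d
    unfolding F[OF that] using a by (intro sum.mono_neutral_right) auto
  show ?thesis
  proof (cases "D = 0")
    case True
    \<comment> \<open>In dimension 0 the count is eventually constant, so it is the dimension of the
      whole quotient.\<close>
    have "int (std_count n I d) = a 0" if "d \<ge> d0" for d using F'[OF that] True by simp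
    then have "std_count n I d = nat (a 0)" if "d \<ge> d0" for d using that by (metis nat_int)
    then have "quot_dim n I (carrier (poly_ring n)) = nat (a 0)"
      by (rule quot_dim_carrier[OF I(1,3)])
    moreover have "a 0 \<ge> 0" using \<open>\<And>d. d \<ge> d0 \<Longrightarrow> int (std_count n I d) = a 0\<close>[of d0] by simp
    ultimately show ?thesis using True by (simp add: ideal_degree_def dim)
  next
    case False
    define E where "E = D - 1"
    have D: "D = Suc E" using False by (simp add: E_def)
    define p :: "rat poly" where "p = (\<Sum>i\<le>E. Polynomial.smult (of_int (a (Suc i))) (binom_poly i))"
    have "poly p (of_nat d) = of_nat (hilbert_function n I d)" if d: "d \<ge> Suc d0" for d
    proof -
      obtain d' where d': "d = Suc d'" "d' \<ge> d0" using d by (cases d) auto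
      have "int (hilbert_function n I d) = int (std_count n I d) - int (std_count n I d')"
        using hilbert_function_std_count[OF I(1,3,2), of d'] d' by simp
      also have "\<dots> = (\<Sum>i\<le>D. a i * int ((d + i) choose i)) - (\<Sum>i\<le>D. a i * int ((d' + i) choose i))"
        using F'[of d] F'[of d'] d' by simp
      also have "\<dots> = (\<Sum>i\<le>D. a i * (int ((d + i) choose i) - int ((d' + i) choose i)))"
        by (simp only: sum_subtractf[symmetric] right_diff_distrib)
      \<comment> \<open>By Pascal's rule the difference for \<open>Suc i\<close> is the binomial for
        \<open>i\<close>; the summand for 0 cancels.\<close>
      also have "\<dots> = (\<Sum>i\<le>E. a (Suc i) * int ((d + i) choose i))"
        unfolding D d' by (subst sum.atMost_Suc_shift) simp
      finally have "rat_of_int (int (hilbert_function n I d))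
          = (\<Sum>i\<le>E. of_int (a (Suc i)) * of_nat ((d + i) choose i))" by simp
      then show ?thesis by (simp add: p_def poly_sum poly_binom_poly)
    qed
    then have "hilbert_polynomial n I = p"
      by (intro hilbert_polynomialI) (auto simp: eventually_sequentially)
    moreover have "lead_coeff p = of_int (a D) / fact E"
      unfolding p_def D using a(2) D by (intro sum_binom_poly(2)) auto
    ultimately show ?thesis using D by (simp add: ideal_degree_def dim)
  qed
qed

theorem theorem3p7:
  fixes n D :: nat and I H :: "'k::field mpoly set"
  assumes "infinite (UNIV :: 'k set)"
    and "ideal I (poly_ring n)"
    and "homogeneous_ideal n I"
    and "I \<noteq> {0}"
    and "I \<noteq> carrier (poly_ring n)"
    and "ideal_dim n I = enat D"
    and "pommaret_basis n I H"
  shows "ideal_degree n I =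
    (\<Sum>h | h \<in> H \<and> D \<le> card (XP n h) \<and> card (XP n h) \<le> D + poly_deg h.
       (-1) ^ (card (XP n h) - D + 1) * of_nat (poly_deg h choose (card (XP n h) - D)))"
proof -
  note I = assms(2) homogeneous_ideal_graded[OF assms(3)] assms(5)
  note HP = assms(2,5,7)
  have "D < n" by (rule ideal_dim_less[OF I assms(6,4)])
  have fin: "finite H" by (rule finite_pommaret_basis[OF HP])
  define k where "k h = card (XP n h)" for h :: "'k mpoly"
  \<comment> \<open>Coefficients from \<open>binomial_shift_expansion\<close>, padded by 0 above
    \<open>k h\<close> so that all cones share the range up to \<open>n\<close>.\<close>
  define c where "c h i = (if i \<le> k h then (- 1) ^ (k h - i) * int (poly_deg h choose (k h - i)) else 0)"
    for h :: "'k mpoly" and i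
  \<comment> \<open>The 1 at index \<open>n\<close> accounts for all terms of the ring, from which
    the cones are removed.\<close>
  define a where "a i = (if i = n then 1 else 0) - (\<Sum>h\<in>H. c h i)" for i
  \<comment> \<open>The sum serves as a bound for each single degree.\<close>
  define d0 where "d0 = (\<Sum>h\<in>H. poly_deg h)"
  have "int (std_count n I d) = (\<Sum>i\<le>n. a i * int ((d + i) choose i))" if d: "d \<ge> d0" for d
  proof -
    have deg: "poly_deg h \<le> d" if "h \<in> H" for h
      using member_le_sum[OF that _ fin, of poly_deg] d by (simp add: d0_def)
    have cone: "int ((d - poly_deg h + k h) choose k h) = (\<Sum>i\<le>n. c h i * int ((d + i) choose i))"
      if "h \<in> H" for h
    proof -
      have "int ((d - poly_deg h + k h) choose k h) = (\<Sum>i\<le>k h. c h i * int ((d + i) choose i))"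
        using binomial_shift_expansion[OF deg[OF that], of "k h"] by (simp add: c_def)
      also have "\<dots> = (\<Sum>i\<le>n. c h i * int ((d + i) choose i))"
        using card_XP_le[OF HP that] by (intro sum.mono_neutral_left) (auto simp: c_def k_def)
      finally show ?thesis .
    qed
    have "int (std_count n I d) = int ((d + n) choose n) - (\<Sum>h\<in>H. int ((d - poly_deg h + k h) choose k h))"
      using std_count_pommaret[OF HP deg] by (simp add: k_def flip: of_nat_sum)
    also have "(\<Sum>h\<in>H. int ((d - poly_deg h + k h) choose k h)) = (\<Sum>h\<in>H. \<Sum>i\<le>n. c h i * int ((d + i) choose i))"
      using cone by (intro sum.cong) auto
    also have "\<dots> = (\<Sum>i\<le>n. (\<Sum>h\<in>H. c h i) * int ((d + i) choose i))"
      by (subst sum.swap) (simp add: sum_distrib_right)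
    also have "int ((d + n) choose n) = (\<Sum>i\<le>n. (if i = n then 1 else 0) * int ((d + i) choose i))"
      by (simp add: if_distrib[of "\<lambda>x. x * _"] sum.delta cong: if_cong)
    finally show ?thesis by (simp add: a_def sum_subtractf left_diff_distrib)
  qed
  then have "ideal_degree n I = of_int (a D)"
    by (rule ideal_degree_eq_binomial_coefficient[OF I assms(6)])
  \<comment> \<open>Because \<open>D < n\<close>, the 1 at index \<open>n\<close> does not enter
    \<open>a D\<close>.\<close>
  also have "\<dots> = (\<Sum>h\<in>H. - of_int (c h D))"
    using \<open>D < n\<close> by (simp add: a_def sum_negf)
  \<comment> \<open>Elements with fewer than \<open>D\<close> multiplicative variables drop out by
    the padding, those with more than \<open>D + poly_deg h\<close> because the binomial coefficient
    is 0. The minus sign moves into the exponent.\<close>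
  also have "\<dots> = (\<Sum>h | h \<in> H \<and> D \<le> k h \<and> k h \<le> D + poly_deg h.
       (-1) ^ (k h - D + 1) * of_nat (poly_deg h choose (k h - D)))"
    using fin by (intro sum.mono_neutral_cong_right) (auto simp: c_def binomial_eq_0)
  finally show ?thesis by (simp only: k_def)
qed

end
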